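(* Consider the regression model $y_i=f(t_i)\varepsilon_i+\sigma z_i$, $i=1,\dots,N$, with i.i.d. standard Gaussian noises $\varepsilon_i$, $z_i$ and i.i.d. design points $t_i$ with known density $g$ on $[0,b]$. Assume that (A.1) $f\in L^2[0,b)$ and there is a constant $0<M_2<\infty$ with $|f(t)|\le M_2$ for all $t\in[0,b)$; (A.2) there are constants $0<m_1\le m_2<\infty$ with $m_1\le g(t)\le m_2$ on $[0,b)$; (A.3) $h=f^2$ belongs to the Laguerre-Sobolev ball $\mathbf{B}^s(A)$, where $A>0$ and $s\ge 1/2$. Let $\widehat h_M$ be the Laguerre hard-thresholding estimator with truncation level $M=N$ and thresholds $\lambda_l=\gamma\sqrt{\ln N}/\sqrt{N}$. Let $\tau>0$ be the exponent in the large deviation bound $$\Pr\left(|\widehat\theta_l-\theta_l|>\rho\lambda_l\right)=O\left(N^{-\tau}\right),\qquad l=1,\dots,M-1,$$ for some $0<\rho<1$ (with implied constant uniform in $l$ and $h$). If $\gamma$ is such that this bound holds with $\tau$ large enough (i.e. $\tau\ge\tau_0$ for a suitable constant $\tau_0$), then there is a constant $C>0$ not depending on $N$ such that, as $N\to\infty$ (i.e. for all sufficiently large $N$), $$\sup_{h\in \mathbf{B}^s(A)}\mathbb{E}\|\widehat h_M-h\|^2\ \le\ C A^2\left[\frac{\ln N}{A^2N}\right]^{\frac{2s}{2s+1}}.$$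
   Context: Model: one observes $(t_1,y_1),\dots,(t_N,y_N)$ with $y_i=f(t_i)\varepsilon_i+\sigma z_i$, where $\sigma>0$ is a known constant, $f$ is an unknown real-valued function on $[0,b]$ ($b>0$ fixed), the $t_i$ are i.i.d. with known probability density $g$ supported on $[0,b]$, and the $\varepsilon_i$ and the $z_i$ are i.i.d. Gaussian with mean $0$ and variance $1$; the sequences $(t_i)$, $(\varepsilon_i)$, $(z_i)$ are independent of one another. The function to be estimated is $h=f^2$ (extended by $0$ outside $[0,b]$). Laguerre functions: $\varphi_k(t)=e^{-t/2}L_k(t)$, $k=0,1,2,\dots$, with $L_k$ the Laguerre polynomials; they form an orthonormal basis of $L^2([0,\infty))$. The Laguerre coefficients of $h$ are $\theta_k=\int_0^b h(t)\varphi_k(t)\,dt$. The norm $\|\cdot\|$ is that of $L^2([0,\infty))$. Laguerre-Sobolev ball: $\mathbf{B}^s(A)=\{h\in L^2[0,b]:\ \sum_{l=0}^\infty (l\vee 1)^{2s}\theta_l^2\le A^2\}$, where $a\vee b=\max(a,b)$. The supremum over $h\in\mathbf{B}^s(A)$ is over those $h=f^2$ with $f$ satisfying (A.1). Coefficient estimator: with $\mathbb{I}$ the indicator function, $$\widehat\theta_k=\frac1N\sum_{i=1}^N\left[y_i^2\frac{\varphi_k(t_i)}{g(t_i)}-\sigma^2\int_0^b\varphi_k(t)\,dt\right]\mathbb{I}(\Omega_k(i)),$$ where $\Omega_k(i)$ is the event $\left|y_i^2\frac{\varphi_k(t_i)}{g(t_i)}-\sigma^2\int_0^b\varphi_k(t)\,dt\right|\le\sqrt{N/\ln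 N}$. Hard-thresholding estimator: $\widehat h_M(t)=\sum_{l=0}^{M-1}\widehat\theta_l\,\mathbb{I}(|\widehat\theta_l|>\lambda_l)\,\varphi_l(t)$. Here $\gamma>0$ is the threshold constant. *)

theory Defs
  imports "HOL-Probability.Probability"
begin

definition laguerre :: "nat \<Rightarrow> real \<Rightarrow> real" where
  "laguerre k x = (\<Sum>j\<le>k. real (k choose j) * (- x) ^ j / fact j)"

definition laguerre_fun :: "nat \<Rightarrow> real \<Rightarrow> real" where
  "laguerre_fun k x = exp (- x / 2) * laguerre k x"

definition laguerre_coeff :: "real \<Rightarrow> (real \<Rightarrow> real) \<Rightarrow> nat \<Rightarrow> real" where
  "laguerre_coeff b h k = (LINT x:{0..b}|lborel. h x * laguerre_fun k x)"

text \<open>The ball \<open>\<^bold>B\<^sup>s(A)\<close>. Elements of \<open>L\<^sup>2[0,b]\<close> are represented by Borel functions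
  vanishing outside \<open>[0,b]\<close>.\<close>

definition laguerre_sobolev_ball :: "real \<Rightarrow> real \<Rightarrow> real \<Rightarrow> (real \<Rightarrow> real) set" where
  "laguerre_sobolev_ball b s A =
     {h. h \<in> borel_measurable borel \<and> (\<forall>x. x \<notin> {0..b} \<longrightarrow> h x = 0) \<and>
         set_integrable lborel {0..b} (\<lambda>x. (h x)\<^sup>2) \<and>
         summable (\<lambda>l. max (real l) 1 powr (2 * s) * (laguerre_coeff b h l)\<^sup>2) \<and>
         (\<Sum>l. max (real l) 1 powr (2 * s) * (laguerre_coeff b h l)\<^sup>2) \<le> A\<^sup>2}"

definition bounded_L2 :: "real \<Rightarrow> real \<Rightarrow> (real \<Rightarrow> real) \<Rightarrow> bool" where
  "bounded_L2 b B f \<longleftrightarrow>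
     f \<in> borel_measurable borel \<and> set_integrable lborel {0..<b} (\<lambda>x. (f x)\<^sup>2) \<and>
     (\<forall>x\<in>{0..<b}. \<bar>f x\<bar> \<le> B)"

definition square_ext :: "real \<Rightarrow> (real \<Rightarrow> real) \<Rightarrow> real \<Rightarrow> real" where
  "square_ext b f x = (if x \<in> {0..b} then (f x)\<^sup>2 else 0)"

text \<open>The functions \<open>h = f\<^sup>2\<close> of the ball with \<open>\<bar>f\<bar> \<le> B\<close> are parametrised by \<open>f\<close>, because the
  observations depend on \<open>f\<close>. The values of \<open>f\<close> outside \<open>[0,b]\<close> play no role, since the design
  points lie in \<open>[0,b]\<close> almost surely.\<close>

definition regression_class :: "real \<Rightarrow> real \<Rightarrow> real \<Rightarrow> real \<Rightarrow> (real \<Rightarrow> real) set" where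
  "regression_class b B s A =
     {f. bounded_L2 b B f \<and> square_ext b f \<in> laguerre_sobolev_ball b s A}"

text \<open>Independence within each of the three sequences and between the sequences amounts to
  independence of the single family indexed by the disjoint sum of their index sets.\<close>

locale regression_model = prob_space M for M :: "'a measure" +
  fixes b \<sigma> :: real and g :: "real \<Rightarrow> real" and t \<epsilon> z :: "nat \<Rightarrow> 'a \<Rightarrow> real"
  assumes b_pos: "0 < b"
    and sigma_pos: "0 < \<sigma>"
    and density_nonneg: "\<And>x. 0 \<le> g x"
    and density_support: "\<And>x. x \<notin> {0..b} \<Longrightarrow> g x = 0"
    and design: "\<And>i. distributed M lborel (t i) g"
    and noise_mult: "\<And>i. distributed M lborel (\<epsilon> i) std_normal_density"
    and noise_add: "\<And>i. distributed M lborel (z i) std_normal_density"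
    and independent: "indep_vars (\<lambda>_. borel) (case_sum t (case_sum \<epsilon> z)) UNIV"

definition observation ::
  "(real \<Rightarrow> real) \<Rightarrow> real \<Rightarrow> (nat \<Rightarrow> 'a \<Rightarrow> real) \<Rightarrow> (nat \<Rightarrow> 'a \<Rightarrow> real) \<Rightarrow> (nat \<Rightarrow> 'a \<Rightarrow> real) \<Rightarrow>
   nat \<Rightarrow> 'a \<Rightarrow> real" where
  "observation f \<sigma> t \<epsilon> z i \<omega> = f (t i \<omega>) * \<epsilon> i \<omega> + \<sigma> * z i \<omega>"

definition coeff_term ::
  "real \<Rightarrow> real \<Rightarrow> (real \<Rightarrow> real) \<Rightarrow> nat \<Rightarrow> real \<Rightarrow> real \<Rightarrow> real" where
  "coeff_term b \<sigma> g k x y =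
     y\<^sup>2 * (laguerre_fun k x / g x) - \<sigma>\<^sup>2 * (LINT u:{0..b}|lborel. laguerre_fun k u)"

text \<open>In the estimators, \<open>x\<close> and \<open>y\<close> are the sample sequences, of which the entries with
  index \<open>1, \<dots>, N\<close> are used.\<close>

definition coeff_estimator ::
  "real \<Rightarrow> real \<Rightarrow> (real \<Rightarrow> real) \<Rightarrow> nat \<Rightarrow> (nat \<Rightarrow> real) \<Rightarrow> (nat \<Rightarrow> real) \<Rightarrow> nat \<Rightarrow> real" where
  "coeff_estimator b \<sigma> g N x y k =
     (1 / real N) * (\<Sum>i=1..N. coeff_term b \<sigma> g k (x i) (y i) *
        of_bool (\<bar>coeff_term b \<sigma> g k (x i) (y i)\<bar> \<le> sqrt (real N / ln (real N))))"

definition threshold_estimator ::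
  "real \<Rightarrow> real \<Rightarrow> (real \<Rightarrow> real) \<Rightarrow> nat \<Rightarrow> nat \<Rightarrow> (nat \<Rightarrow> real) \<Rightarrow>
   (nat \<Rightarrow> real) \<Rightarrow> (nat \<Rightarrow> real) \<Rightarrow> real \<Rightarrow> real" where
  "threshold_estimator b \<sigma> g N m thr x y u =
     (\<Sum>l<m. coeff_estimator b \<sigma> g N x y l *
        of_bool (\<bar>coeff_estimator b \<sigma> g N x y l\<bar> > thr l) * laguerre_fun l u)"

definition threshold :: "real \<Rightarrow> nat \<Rightarrow> nat \<Rightarrow> real" where
  "threshold \<gamma> N l = \<gamma> * sqrt (ln (real N)) / sqrt (real N)"

definition risk ::
  "'a measure \<Rightarrow> real \<Rightarrow> real \<Rightarrow> (real \<Rightarrow> real) \<Rightarrow> (nat \<Rightarrow> 'a \<Rightarrow> real) \<Rightarrow> (nat \<Rightarrow> 'a \<Rightarrow> real) \<Rightarrow>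
   (nat \<Rightarrow> 'a \<Rightarrow> real) \<Rightarrow> nat \<Rightarrow> nat \<Rightarrow> (nat \<Rightarrow> real) \<Rightarrow> (real \<Rightarrow> real) \<Rightarrow> ennreal" where
  "risk M b \<sigma> g t \<epsilon> z N m thr f =
     (\<integral>\<^sup>+\<omega>. (\<integral>\<^sup>+u\<in>{0..}. ennreal ((threshold_estimator b \<sigma> g N m thr
          (\<lambda>i. t i \<omega>) (\<lambda>i. observation f \<sigma> t \<epsilon> z i \<omega>) u - square_ext b f u)\<^sup>2) \<partial>lborel) \<partial>M)"

text \<open>The order symbol \<open>O(N\<^sup>-\<^sup>\<tau>)\<close>, as \<open>N\<close> tends to infinity, has a constant uniform in
  \<open>l = 1, \<dots>, N - 1\<close> and in \<open>f\<close> (hence in \<open>h = f\<^sup>2\<close>) ranging over the class \<open>F\<close>.\<close>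

definition large_deviation_bound ::
  "'a measure \<Rightarrow> real \<Rightarrow> real \<Rightarrow> (real \<Rightarrow> real) \<Rightarrow> (nat \<Rightarrow> 'a \<Rightarrow> real) \<Rightarrow> (nat \<Rightarrow> 'a \<Rightarrow> real) \<Rightarrow>
   (nat \<Rightarrow> 'a \<Rightarrow> real) \<Rightarrow> (real \<Rightarrow> real) set \<Rightarrow> real \<Rightarrow> real \<Rightarrow> real \<Rightarrow> bool" where
  "large_deviation_bound M b \<sigma> g t \<epsilon> z F \<gamma> \<rho> \<tau> \<longleftrightarrow>
     (\<exists>K. \<forall>\<^sub>F N in sequentially. \<forall>f\<in>F. \<forall>l\<in>{1..N - 1}.
        measure M {\<omega> \<in> space M.
          \<bar>coeff_estimator b \<sigma> g N (\<lambda>i. t i \<omega>) (\<lambda>i. observation f \<sigma> t \<epsilon> z i \<omega>) l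
             - laguerre_coeff b (square_ext b f) l\<bar> > \<rho> * threshold \<gamma> N l}
        \<le> K * real N powr (- \<tau>))"

end

theory Submission
  imports Defs
begin

text \<open>The coefficient estimates are compared with the true coefficients one by one, and the
  comparison is summed by Parseval's identity for the Laguerre functions.

  Completeness. The Laguerre functions are orthonormal on the half-line (\<open>laguerre_fun_orthonormal\<close>).
  For a decaying exponential the coefficients are geometric, so Parseval's identity is explicit
  (\<open>parseval_exp\<close>). Finite sums of the exponentials \<open>exp (- k x)\<close>, \<open>k \<ge> 1\<close>, are dense, by the substitution
  \<open>u = exp (- x)\<close> and the Weierstrass theorem (\<open>exp_sums_dense\<close>). Hence Parseval's identity holds for
  bounded functions supported in \<open>[0, b]\<close> (\<open>parseval_laguerre\<close>), and the loss is the sum over \<open>l < N\<close> of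
  the squared errors of the thresholded coefficients plus the tail of the squared true coefficients.

  Thresholding. Where the estimate deviates from the coefficient \<open>\<theta>\<close> by at most \<open>\<rho>\<close> times the
  threshold \<open>\<lambda>\<close>, the squared error of the thresholded coefficient is at most a multiple of \<open>min (\<theta>\<^sup>2) (\<lambda>\<^sup>2)\<close>
  (\<open>hard_threshold_error_good\<close>). Elsewhere it is of order \<open>N\<close>, since the estimators are truncated and the
  coefficients are at most \<open>A\<close> in absolute value; this event has probability of order \<open>N powr (- 3)\<close> when the deviation
  exponent is at least \<open>3\<close>, so all \<open>N\<close> such contributions are of order \<open>1 / N\<close>. The coefficient with
  index \<open>0\<close>, to which the deviation inequality does not apply, has mean squared error of order
  \<open>ln N / N\<close> by a variance and bias estimate (\<open>coeff_estimator_risk\<close>).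

  Rate. In the Sobolev ball, the sum of \<open>min (\<theta>\<^sup>2) (\<lambda>\<^sup>2)\<close> is at most \<open>J \<lambda>\<^sup>2 + A\<^sup>2 J powr (- 2 s)\<close> for every
  cutoff \<open>J \<ge> 1\<close> (\<open>sobolev_sequence_bounds\<close>); the choice of \<open>J\<close> as a power of \<open>N / ln N\<close> that makes both
  terms comparable gives the rate (\<open>balanced_cutoff\<close>, \<open>risk_le\<close>). All constants are uniform in \<open>f\<close>.\<close>

section \<open>Orthonormality of the Laguerre functions\<close>

text \<open>Lebesgue measure on \<open>[0, \<infinity>)\<close>, encoded as a measure on all Borel sets of the real line with
  an indicator density, so that the functions involved need no restriction of their domain.\<close>

definition half_line :: "real measure" where
  "half_line = density lborel (\<lambda>x. ennreal (indicator {0..} x))"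

lemma space_half_line [simp]: "space half_line = UNIV"
  and sets_half_line [simp, measurable_cong]: "sets half_line = sets borel"
  by (simp_all add: half_line_def)

lemma integrable_half_line:
  fixes f :: "real \<Rightarrow> real"
  assumes [measurable]: "f \<in> borel_measurable borel"
  shows "integrable half_line f \<longleftrightarrow> integrable lborel (\<lambda>x. indicator {0..} x * f x)"
  unfolding half_line_def by (subst integrable_real_density) auto

lemma integral_half_line:
  fixes f :: "real \<Rightarrow> real"
  assumes [measurable]: "f \<in> borel_measurable borel"
  shows "integral\<^sup>L half_line f = (\<integral>x. indicator {0..} x * f x \<partial>lborel)"
  unfolding half_line_def by (subst integral_real_density) auto

lemma nn_integral_half_line:
  assumes [measurable]: "f \<in> borel_measurable borel"
  shows "integral\<^sup>N half_line f = (\<integral>\<^sup>+x\<in>{0..}. f x \<partial>lborel)"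
  unfolding half_line_def
  by (subst nn_integral_density) (auto intro!: nn_integral_cong simp: indicator_def)

lemma AE_half_line: "(AE x in half_line. P x) \<longleftrightarrow> (AE x in lborel. 0 \<le> x \<longrightarrow> P x)"
  unfolding half_line_def by (subst AE_density) (auto simp: indicator_def)

lemma moment_exp_half_line:
  assumes p: "0 < p"
  shows "has_bochner_integral half_line (\<lambda>x. x ^ m * exp (- p * x)) (fact m / p ^ Suc m)"
proof (rule has_bochner_integral_nn_integral)
  have "integral\<^sup>N half_line (\<lambda>x. ennreal (x ^ m * exp (- p * x)))
      = (\<integral>\<^sup>+x. ennreal (fact m / p ^ Suc m) * ennreal (erlang_density m p x) \<partial>lborel)"
    using p by (subst nn_integral_half_line)
       (auto intro!: nn_integral_cong simp: erlang_density_def indicator_def ennreal_mult'[symmetric])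
  also have "\<dots> = ennreal (fact m / p ^ Suc m) * (\<integral>\<^sup>+x. ennreal (erlang_density m p x) \<partial>lborel)"
    by (rule nn_integral_cmult) simp
  also have "(\<integral>\<^sup>+x. ennreal (erlang_density m p x) \<partial>lborel) = 1"
    using nn_integral_erlang_ith_moment[OF p, of m 0] by simp
  finally show "integral\<^sup>N half_line (\<lambda>x. ennreal (x ^ m * exp (- p * x))) = ennreal (fact m / p ^ Suc m)"
    by simp
  show "AE x in half_line. 0 \<le> x ^ m * exp (- p * x)"
    by (simp add: AE_half_line)
  show "0 \<le> fact m / p ^ Suc m" using p by simp
qed simp

lemma alternating_binomial_sum_Suc:
  fixes a :: "nat \<Rightarrow> real"
  shows "(\<Sum>i\<le>Suc k. (- 1) ^ i * real (Suc k choose i) * a i)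
       = (\<Sum>i\<le>k. (- 1) ^ i * real (k choose i) * (a i - a (Suc i)))"
proof -
  have "(\<Sum>i\<le>Suc k. (- 1) ^ i * real (Suc k choose i) * a i)
      = a 0 + (\<Sum>i\<le>k. (- 1) ^ Suc i * real (Suc k choose Suc i) * a (Suc i))"
    by (subst sum.atMost_Suc_shift) simp
  also have "(\<Sum>i\<le>k. (- 1) ^ Suc i * real (Suc k choose Suc i) * a (Suc i))
      = - (\<Sum>i\<le>k. (- 1) ^ i * real (k choose i) * a (Suc i))
        + (\<Sum>i\<le>k. (- 1) ^ Suc i * real (k choose Suc i) * a (Suc i))"
    by (simp add: sum_negf[symmetric] sum.distrib[symmetric] algebra_simps)
  also have "a 0 + (- (\<Sum>i\<le>k. (- 1) ^ i * real (k choose i) * a (Suc i))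
        + (\<Sum>i\<le>k. (- 1) ^ Suc i * real (k choose Suc i) * a (Suc i)))
      = (\<Sum>i\<le>Suc k. (- 1) ^ i * real (k choose i) * a i) - (\<Sum>i\<le>k. (- 1) ^ i * real (k choose i) * a (Suc i))"
    by (subst sum.atMost_Suc_shift) simp
  finally show ?thesis
    by (simp add: sum_subtractf binomial_eq_0 algebra_simps)
qed

text \<open>Up to sign, the left-hand side is the \<open>k\<close>-th finite difference of the binomial coefficient
  \<open>m \<mapsto> (m choose j)\<close>, and each difference lowers the lower index by one (Pascal's rule).\<close>

lemma alternating_binomial_sum:
  "(\<Sum>i\<le>k. (- 1) ^ i * real (k choose i) * real ((i + m) choose j))
     = (if j < k then 0 else (- 1) ^ k * real (m choose (j - k)))"
proof (induction k arbitrary: j)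
  case (Suc k)
  show ?case
  proof (cases j)
    case 0
    then show ?thesis by (subst alternating_binomial_sum_Suc) simp
  next
    case (Suc j')
    have "(\<Sum>i\<le>k. (- 1) ^ i * real (k choose i)
              * (real ((i + m) choose j) - real ((Suc i + m) choose j)))
        = - (\<Sum>i\<le>k. (- 1) ^ i * real (k choose i) * real ((i + m) choose j'))"
      by (simp add: Suc sum_negf[symmetric] algebra_simps)
    then show ?thesis
      by (subst alternating_binomial_sum_Suc) (simp add: Suc Suc.IH)
  qed
qed simp

lemma laguerre_fun_measurable [measurable]: "laguerre_fun k \<in> borel_measurable borel"
  unfolding laguerre_fun_def[abs_def] laguerre_def[abs_def] by measurable

text \<open>In particular the \<open>k\<close>-th Laguerre polynomial is orthogonal to all monomials of degree below
  \<open>k\<close> for the weight \<open>exp (- x)\<close>; orthonormality of the Laguerre functions follows at once.\<close>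

lemma moment_laguerre:
  "has_bochner_integral half_line (\<lambda>x. x ^ j * exp (- x) * laguerre k x)
     (fact j * (- 1) ^ k * real (j choose k))"
proof -
  have "has_bochner_integral half_line
      (\<lambda>x. \<Sum>i\<le>k. (real (k choose i) * (- 1) ^ i / fact i) * (x ^ (i + j) * exp (- 1 * x)))
      (\<Sum>i\<le>k. (real (k choose i) * (- 1) ^ i / fact i) * (fact (i + j) / 1 ^ Suc (i + j)))"
    by (intro has_bochner_integral_sum has_bochner_integral_mult_right moment_exp_half_line) auto
  also have "(\<lambda>x. \<Sum>i\<le>k. (real (k choose i) * (- 1) ^ i / fact i) * (x ^ (i + j) * exp (- 1 * x)))
      = (\<lambda>x. x ^ j * exp (- x) * laguerre k x)"
  proof (rule ext)
    fix x :: real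
    show "(\<Sum>i\<le>k. (real (k choose i) * (- 1) ^ i / fact i) * (x ^ (i + j) * exp (- 1 * x)))
        = x ^ j * exp (- x) * laguerre k x"
      by (simp add: laguerre_def sum_distrib_left power_add power_minus[of x] mult_ac)
  qed
  also have "(\<Sum>i\<le>k. (real (k choose i) * (- 1) ^ i / fact i) * (fact (i + j) / 1 ^ Suc (i + j)))
      = fact j * (\<Sum>i\<le>k. (- 1) ^ i * real (k choose i) * real ((i + j) choose j))"
    by (auto simp: sum_distrib_left binomial_fact field_simps intro!: sum.cong)
  also have "\<dots> = fact j * (- 1) ^ k * real (j choose k)"
    by (subst alternating_binomial_sum) (simp add: binomial_eq_0 binomial_symmetric[symmetric])
  finally show ?thesis .
qed

lemma laguerre_fun_orthonormal_le:
  assumes "l \<le> k"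
  shows "has_bochner_integral half_line (\<lambda>x. laguerre_fun l x * laguerre_fun k x) (of_bool (l = k))"
proof -
  have "has_bochner_integral half_line
      (\<lambda>x. \<Sum>j\<le>l. (real (l choose j) * (- 1) ^ j / fact j) * (x ^ j * exp (- x) * laguerre k x))
      (\<Sum>j\<le>l. (real (l choose j) * (- 1) ^ j / fact j) * (fact j * (- 1) ^ k * real (j choose k)))"
    by (intro has_bochner_integral_sum has_bochner_integral_mult_right moment_laguerre)
  also have "(\<lambda>x. \<Sum>j\<le>l. (real (l choose j) * (- 1) ^ j / fact j) * (x ^ j * exp (- x) * laguerre k x))
      = (\<lambda>x. laguerre_fun l x * laguerre_fun k x)"
  proof (rule ext)
    fix x :: real
    have "exp (- x) = exp (- x / 2) * exp (- x / 2)"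
      by (simp add: exp_add[symmetric])
    then have "laguerre_fun l x * laguerre_fun k x = laguerre l x * (exp (- x) * laguerre k x)"
      by (simp add: laguerre_fun_def)
    then show "(\<Sum>j\<le>l. (real (l choose j) * (- 1) ^ j / fact j) * (x ^ j * exp (- x) * laguerre k x))
        = laguerre_fun l x * laguerre_fun k x"
      by (simp add: laguerre_def[of l] sum_distrib_right power_minus[of x] mult.assoc)
  qed
  also have "(\<Sum>j\<le>l. (real (l choose j) * (- 1) ^ j / fact j) * (fact j * (- 1) ^ k * real (j choose k)))
      = of_bool (l = k)"
  proof (cases "l = k")
    case True
    have "(\<Sum>j\<le>k. (real (k choose j) * (- 1) ^ j / fact j) * (fact j * (- 1) ^ k * real (j choose k)))
        = (\<Sum>j\<in>{k}. (real (k choose j) * (- 1) ^ j / fact j) * (fact j * (- 1) ^ k * real (j choose k)))"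
      by (rule sum.mono_neutral_right) auto
    then show ?thesis using True by (simp add: power_add[symmetric])
  next
    case False
    with assms show ?thesis by (auto intro!: sum.neutral)
  qed
  finally show ?thesis .
qed

lemma laguerre_fun_orthonormal:
  "has_bochner_integral half_line (\<lambda>x. laguerre_fun l x * laguerre_fun k x) (of_bool (l = k))"
proof (cases "l \<le> k")
  case False
  then have "has_bochner_integral half_line (\<lambda>x. laguerre_fun k x * laguerre_fun l x) (of_bool (k = l))"
    by (intro laguerre_fun_orthonormal_le) simp
  then show ?thesis by (simp add: mult.commute eq_commute)
qed (rule laguerre_fun_orthonormal_le)

lemma laguerre_coeff_exp:
  assumes p: "0 < p"
  shows "has_bochner_integral half_line (\<lambda>x. exp (- p * x) * laguerre_fun k x)
           ((1 - 1 / (p + 1 / 2)) ^ k / (p + 1 / 2))"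
proof -
  define q where "q = p + 1 / 2"
  have q: "0 < q" using p by (simp add: q_def)
  have "has_bochner_integral half_line
      (\<lambda>x. \<Sum>i\<le>k. (real (k choose i) * (- 1) ^ i / fact i) * (x ^ i * exp (- q * x)))
      (\<Sum>i\<le>k. (real (k choose i) * (- 1) ^ i / fact i) * (fact i / q ^ Suc i))"
    by (intro has_bochner_integral_sum has_bochner_integral_mult_right moment_exp_half_line q)
  also have "(\<lambda>x. \<Sum>i\<le>k. (real (k choose i) * (- 1) ^ i / fact i) * (x ^ i * exp (- q * x)))
      = (\<lambda>x. exp (- p * x) * laguerre_fun k x)"
  proof (rule ext)
    fix x :: real
    have "exp (- q * x) = exp (- p * x) * exp (- x / 2)"
      by (simp add: q_def exp_add[symmetric] algebra_simps)
    then show "(\<Sum>i\<le>k. (real (k choose i) * (- 1) ^ i / fact i) * (x ^ i * exp (- q * x)))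
        = exp (- p * x) * laguerre_fun k x"
      by (simp add: laguerre_fun_def laguerre_def sum_distrib_left power_minus[of x] mult_ac)
  qed
  also have "(\<Sum>i\<le>k. (real (k choose i) * (- 1) ^ i / fact i) * (fact i / q ^ Suc i))
      = (\<Sum>i\<le>k. real (k choose i) * (- 1 / q) ^ i * 1 ^ (k - i)) / q"
    by (simp only: sum_divide_distrib power_divide) (simp add: mult_ac)
  also have "\<dots> = (1 - 1 / q) ^ k / q"
    by (subst binomial_ring[symmetric]) simp
  finally show ?thesis by (simp add: q_def)
qed

text \<open>The coefficients of a decaying exponential form a geometric sequence, so Parseval's identity
  for it is the sum of a geometric series. This replaces the usual appeal to the generating function
  of the Laguerre polynomials.\<close>

lemma parseval_exp:
  assumes p: "0 < p"
  shows "(\<lambda>k. (integral\<^sup>L half_line (\<lambda>x. exp (- p * x) * laguerre_fun k x))\<^sup>2)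
           sums (integral\<^sup>L half_line (\<lambda>x. (exp (- p * x))\<^sup>2))"
proof -
  define q where "q = p + 1 / 2"
  have q: "1 / 2 < q" using p by (simp add: q_def)
  have c: "integral\<^sup>L half_line (\<lambda>x. exp (- p * x) * laguerre_fun k x) = (1 - 1 / q) ^ k / q" for k
    using laguerre_coeff_exp[OF p, of k] by (simp add: has_bochner_integral_integral_eq q_def)
  have "\<bar>1 - 1 / q\<bar> < 1"
    using q by (auto simp: abs_less_iff field_simps)
  then have r: "norm ((1 - 1 / q)\<^sup>2) < 1"
    by (simp add: abs_square_less_1)
  have "(\<lambda>k. (1 / q\<^sup>2) * ((1 - 1 / q)\<^sup>2) ^ k) sums ((1 / q\<^sup>2) * (1 / (1 - (1 - 1 / q)\<^sup>2)))"
    by (intro sums_mult geometric_sums r)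
  also have "(\<lambda>k. (1 / q\<^sup>2) * ((1 - 1 / q)\<^sup>2) ^ k) = (\<lambda>k. ((1 - 1 / q) ^ k / q)\<^sup>2)"
    by (simp add: power_divide power_mult[symmetric] mult.commute)
  also have "(1 / q\<^sup>2) * (1 / (1 - (1 - 1 / q)\<^sup>2)) = 1 / (2 * p)"
  proof -
    have "q * (1 - 1 / q) = q - 1"
      using q by (simp add: right_diff_distrib)
    then have "q\<^sup>2 * (1 - (1 - 1 / q)\<^sup>2) = q\<^sup>2 - (q - 1)\<^sup>2"
      by (simp add: right_diff_distrib flip: power_mult_distrib)
    also have "\<dots> = 2 * p"
      by (simp add: power2_eq_square algebra_simps q_def)
    finally have "q\<^sup>2 * (1 - (1 - 1 / q)\<^sup>2) = 2 * p" .
    then show ?thesis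
      by (simp add: divide_divide_eq_left)
  qed
  also have "1 / (2 * p) = integral\<^sup>L half_line (\<lambda>x. (exp (- p * x))\<^sup>2)"
    using moment_exp_half_line[of "2 * p" 0] p
    by (simp add: has_bochner_integral_integral_eq power2_eq_square exp_add[symmetric] algebra_simps)
  finally show ?thesis unfolding c .
qed

section \<open>Completeness of the Laguerre functions\<close>

text \<open>Membership in \<open>L\<^sup>2([0, \<infinity>))\<close> of an everywhere defined Borel representative.\<close>

definition square_integrable_half_line :: "(real \<Rightarrow> real) \<Rightarrow> bool" where
  "square_integrable_half_line f \<longleftrightarrow>
     f \<in> borel_measurable borel \<and> integrable half_line (\<lambda>x. (f x)\<^sup>2)"

lemma square_integrable_half_line_mult:
  assumes "square_integrable_half_line f" "square_integrable_half_line g"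
  shows "integrable half_line (\<lambda>x. f x * g x)"
proof (rule Bochner_Integration.integrable_bound)
  have [measurable]: "f \<in> borel_measurable borel" "g \<in> borel_measurable borel"
    using assms by (auto simp: square_integrable_half_line_def)
  show "(\<lambda>x. f x * g x) \<in> borel_measurable half_line" by measurable
  show "integrable half_line (\<lambda>x. (f x)\<^sup>2 + (g x)\<^sup>2)"
    using assms by (auto simp: square_integrable_half_line_def)
  have "\<bar>f x * g x\<bar> \<le> (f x)\<^sup>2 + (g x)\<^sup>2" for x
    using sum_squares_bound[of "\<bar>f x\<bar>" "\<bar>g x\<bar>"] abs_ge_zero[of "f x * g x"]
    unfolding power2_abs abs_mult by linarith
  then show "AE x in half_line. norm (f x * g x) \<le> norm ((f x)\<^sup>2 + (g x)\<^sup>2)"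
    by (intro AE_I2) simp
qed

lemma square_integrable_half_line_add:
  assumes "square_integrable_half_line f" "square_integrable_half_line g"
  shows "square_integrable_half_line (\<lambda>x. f x + g x)"
  using assms square_integrable_half_line_mult[OF assms]
  unfolding square_integrable_half_line_def
  by (auto simp: power2_sum mult.assoc)

lemma square_integrable_half_line_scale:
  "square_integrable_half_line f \<Longrightarrow> square_integrable_half_line (\<lambda>x. c * f x)"
  by (auto simp: square_integrable_half_line_def power_mult_distrib)

lemma square_integrable_half_line_diff:
  assumes "square_integrable_half_line f" "square_integrable_half_line g"
  shows "square_integrable_half_line (\<lambda>x. f x - g x)"
  using square_integrable_half_line_add[OF assms(1) square_integrable_half_line_scale[OF assms(2), of "-1"]]
  by simp

lemma square_integrable_half_line_sum:
  "(\<And>i. i \<in> I \<Longrightarrow> square_integrable_half_line (f i)) \<Longrightarrow>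
     square_integrable_half_line (\<lambda>x. \<Sum>i\<in>I. f i x)"
proof (induction I rule: infinite_finite_induct)
  case (insert i I)
  then show ?case by (simp add: square_integrable_half_line_add)
qed (simp_all add: square_integrable_half_line_def)

lemma square_integrable_laguerre_fun: "square_integrable_half_line (laguerre_fun k)"
  using laguerre_fun_orthonormal[of k k]
  by (auto simp: square_integrable_half_line_def power2_eq_square has_bochner_integral_iff)

lemma square_integrable_exp: "0 < p \<Longrightarrow> square_integrable_half_line (\<lambda>x. exp (- p * x))"
  using moment_exp_half_line[of "2 * p" 0]
  by (auto simp: square_integrable_half_line_def power2_eq_square exp_add[symmetric]
      has_bochner_integral_iff algebra_simps)

lemma square_integrable_laguerre_sum:
  "square_integrable_half_line (\<lambda>x. \<Sum>l<n. a l * laguerre_fun l x)"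
  by (intro square_integrable_half_line_sum square_integrable_half_line_scale
      square_integrable_laguerre_fun)

text \<open>The Laguerre coefficients of a function on the whole half-line. For a function vanishing off
  \<open>[0, b]\<close> they agree with \<^const>\<open>laguerre_coeff\<close>.\<close>

definition half_line_coeff :: "(real \<Rightarrow> real) \<Rightarrow> nat \<Rightarrow> real" where
  "half_line_coeff h k = integral\<^sup>L half_line (\<lambda>x. h x * laguerre_fun k x)"

lemma integral_laguerre_sum_diff_square:
  assumes h: "square_integrable_half_line h"
  shows "integral\<^sup>L half_line (\<lambda>x. ((\<Sum>l<n. a l * laguerre_fun l x) - h x)\<^sup>2)
    = (\<Sum>l<n. (a l - half_line_coeff h l)\<^sup>2) + integral\<^sup>L half_line (\<lambda>x. (h x)\<^sup>2)
      - (\<Sum>l<n. (half_line_coeff h l)\<^sup>2)"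
proof -
  have ss: "has_bochner_integral half_line
      (\<lambda>x. \<Sum>l<n. \<Sum>k<n. (a l * a k) * (laguerre_fun l x * laguerre_fun k x))
      (\<Sum>l<n. \<Sum>k<n. (a l * a k) * of_bool (l = k))"
    by (intro has_bochner_integral_sum has_bochner_integral_mult_right laguerre_fun_orthonormal)
  have s1: "(\<Sum>l<n. \<Sum>k<n. (a l * a k) * of_bool (l = k)) = (\<Sum>l<n. (a l)\<^sup>2)"
    by (auto simp: power2_eq_square of_bool_def if_distrib[of "\<lambda>x. _ * x"] sum.If_cases
        intro!: sum.cong)
  have sh: "has_bochner_integral half_line
      (\<lambda>x. \<Sum>l<n. (2 * a l) * (h x * laguerre_fun l x)) (\<Sum>l<n. (2 * a l) * half_line_coeff h l)"
    unfolding half_line_coeff_def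
    by (intro has_bochner_integral_sum has_bochner_integral_mult_right has_bochner_integral_integrable
        square_integrable_half_line_mult h square_integrable_laguerre_fun)
  have hh: "has_bochner_integral half_line (\<lambda>x. (h x)\<^sup>2) (integral\<^sup>L half_line (\<lambda>x. (h x)\<^sup>2))"
    using h by (intro has_bochner_integral_integrable) (simp add: square_integrable_half_line_def)
  have e: "((\<Sum>l<n. a l * laguerre_fun l x) - h x)\<^sup>2
      = ((\<Sum>l<n. \<Sum>k<n. (a l * a k) * (laguerre_fun l x * laguerre_fun k x))
          - (\<Sum>l<n. (2 * a l) * (h x * laguerre_fun l x))) + (h x)\<^sup>2" for x
    by (simp add: power2_diff power2_eq_square[of "sum _ _"] sum_product sum_distrib_left
        sum_distrib_right mult_ac)
  have "has_bochner_integral half_line (\<lambda>x. ((\<Sum>l<n. a l * laguerre_fun l x) - h x)\<^sup>2)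
      (((\<Sum>l<n. (a l)\<^sup>2) - (\<Sum>l<n. (2 * a l) * half_line_coeff h l))
        + integral\<^sup>L half_line (\<lambda>x. (h x)\<^sup>2))"
    unfolding e using has_bochner_integral_add[OF has_bochner_integral_diff[OF ss sh] hh]
    unfolding s1 .
  then have "integral\<^sup>L half_line (\<lambda>x. ((\<Sum>l<n. a l * laguerre_fun l x) - h x)\<^sup>2)
      = ((\<Sum>l<n. (a l)\<^sup>2) - (\<Sum>l<n. (2 * a l) * half_line_coeff h l))
        + integral\<^sup>L half_line (\<lambda>x. (h x)\<^sup>2)"
    by (rule has_bochner_integral_integral_eq)
  then show ?thesis
    by (simp add: power2_diff sum.distrib sum_subtractf algebra_simps)
qed

text \<open>The partial sum with the coefficients of \<open>h\<close>, whose squared error is the left-hand side, is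
  the best \<open>L\<^sup>2\<close> approximation of \<open>h\<close> from the span of the first \<open>n\<close> Laguerre functions.\<close>

lemma laguerre_best_approximation:
  assumes "square_integrable_half_line h"
  shows "integral\<^sup>L half_line (\<lambda>x. (h x)\<^sup>2) - (\<Sum>l<n. (half_line_coeff h l)\<^sup>2)
    \<le> integral\<^sup>L half_line (\<lambda>x. ((\<Sum>l<n. a l * laguerre_fun l x) - h x)\<^sup>2)"
  unfolding integral_laguerre_sum_diff_square[OF assms]
  using sum_nonneg[of "{..<n}" "\<lambda>l. (a l - half_line_coeff h l)\<^sup>2"] by simp

lemma bessel_laguerre:
  assumes "square_integrable_half_line h"
  shows "(\<Sum>l<n. (half_line_coeff h l)\<^sup>2) \<le> integral\<^sup>L half_line (\<lambda>x. (h x)\<^sup>2)"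
proof -
  have "0 \<le> integral\<^sup>L half_line
      (\<lambda>x. ((\<Sum>l<n. half_line_coeff h l * laguerre_fun l x) - h x)\<^sup>2)"
    by simp
  then show ?thesis
    unfolding integral_laguerre_sum_diff_square[OF assms] by simp
qed

lemma parseval_laguerre_if_approximable:
  assumes h: "square_integrable_half_line h"
    and approx: "\<And>e. 0 < e \<Longrightarrow>
      \<exists>n a. integral\<^sup>L half_line (\<lambda>x. ((\<Sum>l<n. a l * laguerre_fun l x) - h x)\<^sup>2) < e"
  shows "(\<lambda>l. (half_line_coeff h l)\<^sup>2) sums integral\<^sup>L half_line (\<lambda>x. (h x)\<^sup>2)"
  unfolding sums_def
proof (rule LIMSEQ_I)
  fix e :: real assume "0 < e"
  then obtain n a where
    na: "integral\<^sup>L half_line (\<lambda>x. ((\<Sum>l<n. a l * laguerre_fun l x) - h x)\<^sup>2) < e"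
    using approx by blast
  have "norm ((\<Sum>l<k. (half_line_coeff h l)\<^sup>2) - integral\<^sup>L half_line (\<lambda>x. (h x)\<^sup>2)) < e" if "n \<le> k" for k
  proof -
    have "(\<Sum>l<n. (half_line_coeff h l)\<^sup>2) \<le> (\<Sum>l<k. (half_line_coeff h l)\<^sup>2)"
      using that by (intro sum_mono2) auto
    then show ?thesis
      using na laguerre_best_approximation[OF h, of n a] bessel_laguerre[OF h, of k] by simp
  qed
  then show "\<exists>n0. \<forall>k\<ge>n0. norm ((\<Sum>l<k. (half_line_coeff h l)\<^sup>2) - integral\<^sup>L half_line (\<lambda>x. (h x)\<^sup>2)) < e"
    by blast
qed

lemma exp_sum_approximable:
  fixes c :: "nat \<Rightarrow> real"
  assumes "0 < e"
  shows "\<exists>n a. integral\<^sup>L half_line (\<lambda>x. ((\<Sum>l<n. a l * laguerre_fun l x)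
             - (\<Sum>i\<le>m. c i * exp (- real (Suc i) * x)))\<^sup>2) < e"
proof -
  define E where "E i x = exp (- real (Suc i) * x)" for i :: nat and x :: real
  define d where "d i n = integral\<^sup>L half_line (\<lambda>x. (E i x)\<^sup>2)
      - (\<Sum>l<n. (half_line_coeff (E i) l)\<^sup>2)" for i n
  have E: "square_integrable_half_line (E i)" for i
    unfolding E_def[abs_def] by (rule square_integrable_exp) simp
  have "(\<lambda>n. d i n) \<longlonglongrightarrow> integral\<^sup>L half_line (\<lambda>x. (E i x)\<^sup>2) - integral\<^sup>L half_line (\<lambda>x. (E i x)\<^sup>2)" for i
    unfolding d_def using parseval_exp[of "real (Suc i)"]
    by (intro tendsto_diff tendsto_const) (simp add: sums_def E_def half_line_coeff_def)
  then have d0: "(\<lambda>n. d i n) \<longlonglongrightarrow> 0" for i by simp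
  have "(\<lambda>n. (\<Sum>i\<le>m. (c i)\<^sup>2 * d i n) * card {..m}) \<longlonglongrightarrow> (\<Sum>i\<le>m. (c i)\<^sup>2 * 0) * card {..m}"
    by (intro tendsto_intros d0)
  then have "(\<lambda>n. (\<Sum>i\<le>m. (c i)\<^sup>2 * d i n) * card {..m}) \<longlonglongrightarrow> 0" by simp
  then have "\<forall>\<^sub>F n in sequentially. (\<Sum>i\<le>m. (c i)\<^sup>2 * d i n) * card {..m} < e"
    using assms by (rule order_tendstoD(2))
  then obtain n where n: "(\<Sum>i\<le>m. (c i)\<^sup>2 * d i n) * card {..m} < e"
    by (auto simp: eventually_sequentially)
  define a where "a l = (\<Sum>i\<le>m. c i * half_line_coeff (E i) l)" for l
  define r where "r i x = (\<Sum>l<n. half_line_coeff (E i) l * laguerre_fun l x) - E i x" for i x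
  have r: "square_integrable_half_line (r i)" for i
    unfolding r_def[abs_def]
    by (intro square_integrable_half_line_diff square_integrable_laguerre_sum E)
  have ir: "integral\<^sup>L half_line (\<lambda>x. (r i x)\<^sup>2) = d i n" for i
    unfolding r_def d_def by (subst integral_laguerre_sum_diff_square[OF E]) simp
  have eq: "(\<Sum>l<n. a l * laguerre_fun l x) - (\<Sum>i\<le>m. c i * exp (- real (Suc i) * x))
      = (\<Sum>i\<le>m. c i * r i x)" for x
  proof -
    have "(\<Sum>l<n. a l * laguerre_fun l x)
        = (\<Sum>l<n. \<Sum>i\<le>m. c i * (half_line_coeff (E i) l * laguerre_fun l x))"
      by (simp add: a_def sum_distrib_right mult.assoc)
    also have "\<dots> = (\<Sum>i\<le>m. \<Sum>l<n. c i * (half_line_coeff (E i) l * laguerre_fun l x))"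
      by (rule sum.swap)
    finally show ?thesis
      by (simp only: r_def E_def sum_distrib_left right_diff_distrib sum_subtractf)
  qed
  have "integral\<^sup>L half_line (\<lambda>x. (\<Sum>i\<le>m. c i * r i x)\<^sup>2)
      \<le> integral\<^sup>L half_line (\<lambda>x. (\<Sum>i\<le>m. (c i)\<^sup>2 * (r i x)\<^sup>2) * card {..m})"
  proof (rule integral_mono)
    show "integrable half_line (\<lambda>x. (\<Sum>i\<le>m. c i * r i x)\<^sup>2)"
      using square_integrable_half_line_sum[of "{..m}" "\<lambda>i x. c i * r i x"]
        square_integrable_half_line_scale[OF r]
      by (simp add: square_integrable_half_line_def)
    show "integrable half_line (\<lambda>x. (\<Sum>i\<le>m. (c i)\<^sup>2 * (r i x)\<^sup>2) * card {..m})"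
      using r by (auto simp: square_integrable_half_line_def)
    show "(\<Sum>i\<le>m. c i * r i x)\<^sup>2 \<le> (\<Sum>i\<le>m. (c i)\<^sup>2 * (r i x)\<^sup>2) * card {..m}" for x
      using sum_squared_le_sum_of_squares[of "\<lambda>i. c i * r i x" "{..m}"]
      by (simp add: power_mult_distrib)
  qed
  also have "\<dots> = (\<Sum>i\<le>m. (c i)\<^sup>2 * d i n) * card {..m}"
    using r by (simp add: square_integrable_half_line_def ir)
  finally show ?thesis
    using n unfolding eq[symmetric] by (intro exI[of _ n] exI[of _ a]) simp
qed

text \<open>The substitution \<open>u = exp (- x)\<close> maps \<open>[0, \<infinity>)\<close> to \<open>(0, 1]\<close> and turns the exponential sums
  into \<open>u\<close> times a polynomial in \<open>u\<close>. A bounded measurable function of \<open>u\<close> is an almost everywhere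
  limit of continuous functions, hence of polynomials by the Weierstrass theorem, and the factor
  \<open>exp (- x)\<close> provides an integrable dominating function.\<close>

lemma exp_sums_dense:
  fixes h :: "real \<Rightarrow> real"
  assumes h [measurable]: "h \<in> borel_measurable borel"
    and bnd: "\<And>x. \<bar>h x\<bar> \<le> B" and supp: "\<And>x. x \<notin> {0..b} \<Longrightarrow> h x = 0"
    and e: "0 < e"
  shows "\<exists>m c. integral\<^sup>L half_line
      (\<lambda>x. ((\<Sum>i\<le>m. c i * exp (- real (Suc i) * x)) - h x)\<^sup>2) < e"
proof -
  define H where "H u = (if 0 < u \<and> u \<le> 1 then h (- ln u) / u else 0)" for u
  define K where "K = B * exp b"
  have B0: "0 \<le> B" using bnd[of 0] by simp
  have K0: "0 \<le> K" using B0 by (simp add: K_def)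
  have [measurable]: "H \<in> borel_measurable borel" unfolding H_def[abs_def] by measurable
  \<comment> \<open>\<open>H\<close> is bounded because \<open>h\<close> vanishes where \<open>u < exp (- b)\<close>.\<close>
  have HK: "\<bar>H u\<bar> \<le> K" for u
  proof (cases "0 < u \<and> u \<le> 1 \<and> - ln u \<le> b")
    case True
    then have "1 / u \<le> exp b"
      using exp_le_cancel_iff[of "- ln u" b] by (simp add: exp_minus inverse_eq_divide)
    then have "\<bar>h (- ln u)\<bar> * (1 / u) \<le> B * exp b"
      using True bnd B0 by (intro mult_mono) auto
    then show ?thesis using True by (simp add: H_def K_def abs_divide)
  next
    case False
    then show ?thesis using supp[of "- ln u"] K0 by (auto simp: H_def)
  qed
  have "H measurable_on UNIV"
    using measurable_on_iff_borel_measurable[of UNIV H]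
    by (simp add: lebesgue_on_UNIV_eq measurable_completion)
  then obtain Z G where Z: "negligible Z" and Gc: "\<And>n. continuous_on UNIV (G n)"
    and GH: "\<And>u. u \<notin> Z \<Longrightarrow> (\<lambda>n. G n u) \<longlonglongrightarrow> H u"
    unfolding measurable_on_def by (auto simp: if_distrib)
  \<comment> \<open>Clamping to the bounds \<open>- K\<close> and \<open>K\<close> of \<open>H\<close> preserves the limit and makes the approximants uniformly bounded.\<close>
  define G' where "G' n u = max (- K) (min K (G n u))" for n :: nat and u
  have G'c: "continuous_on {0..1} (G' n)" for n
    unfolding G'_def[abs_def]
    by (intro continuous_intros continuous_on_subset[OF Gc]) auto
  have G'H: "(\<lambda>n. G' n u) \<longlonglongrightarrow> H u" if "u \<notin> Z" for u
  proof -
    have "(\<lambda>n. G' n u) \<longlonglongrightarrow> max (- K) (min K (H u))"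
      unfolding G'_def by (intro tendsto_intros GH that)
    moreover have "max (- K) (min K (H u)) = H u" using HK[of u] by auto
    ultimately show ?thesis by simp
  qed
  have "\<exists>p. real_polynomial_function p \<and> (\<forall>u\<in>{0..1}. \<bar>G' n u - p u\<bar> < 1 / real (Suc n))" for n
  proof -
    have pos: "0 < 1 / real (Suc n)" by simp
    show ?thesis
      by (rule Stone_Weierstrass_real_polynomial_function[OF compact_Icc G'c[of n] pos]) blast
  qed
  then obtain p where pp: "\<And>n. real_polynomial_function (p n)"
    and pG: "\<And>n u. u \<in> {0..1} \<Longrightarrow> \<bar>G' n u - p n u\<bar> < 1 / real (Suc n)"
    by metis
  have pH: "(\<lambda>n. p n u) \<longlonglongrightarrow> H u" if "u \<notin> Z" "u \<in> {0..1}" for u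
  proof -
    have "(\<lambda>n. p n u - G' n u) \<longlonglongrightarrow> 0"
    proof (rule Lim_null_comparison)
      show "\<forall>\<^sub>F n in sequentially. norm (p n u - G' n u) \<le> 1 / real (Suc n)"
        using pG[OF that(2)] by (intro always_eventually allI) (simp add: abs_minus_commute less_imp_le)
      show "(\<lambda>n. 1 / real (Suc n)) \<longlonglongrightarrow> 0"
        using LIMSEQ_inverse_real_of_nat by (simp add: inverse_eq_divide)
    qed
    from tendsto_add[OF this G'H[OF that(1)]] show ?thesis by simp
  qed
  have pK: "\<bar>p n u\<bar> \<le> K + 1" if "u \<in> {0..1}" for n u
  proof -
    have "\<bar>G' n u\<bar> \<le> K" using K0 by (auto simp: G'_def)
    moreover have "1 / real (Suc n) \<le> 1" by simp
    ultimately show ?thesis using pG[OF that, of n] by linarith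
  qed
  have [measurable]: "p n \<in> borel_measurable borel" for n
    using continuous_on_polymonial_function[of "p n" UNIV] pp[of n]
    by (intro borel_measurable_continuous_onI) (simp add: real_polynomial_function_eq)
  define E where "E n x = exp (- x) * p n (exp (- x))" for n and x :: real
  have hu: "h x = exp (- x) * H (exp (- x))" if "0 \<le> x" for x
    using that by (simp add: H_def)
  \<comment> \<open>The exceptional null set in \<open>u\<close> pulls back to a null set in \<open>x\<close>, as \<open>u \<mapsto> - ln u\<close> is differentiable.\<close>
  have AEZ: "AE x in lborel. exp (- x) \<notin> Z"
  proof -
    have "negligible ((\<lambda>u. - ln u) ` (Z \<inter> {0<..}))"
    proof (rule negligible_differentiable_image_negligible)
      show "negligible (Z \<inter> {0<..})" using Z by (rule negligible_subset) auto
      show "(\<lambda>u. - ln u) differentiable_on (Z \<inter> {0<..})"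
        unfolding differentiable_on_def real_differentiable_def
      proof
        fix x assume "x \<in> Z \<inter> {0<..}"
        then have "((\<lambda>u. - ln u) has_real_derivative - (1 / x)) (at x within Z \<inter> {0<..})"
          by (auto intro!: derivative_eq_intros)
        then show "\<exists>D. ((\<lambda>u. - ln u) has_real_derivative D) (at x within Z \<inter> {0<..})" ..
      qed
    qed simp
    then have "AE x in lebesgue. x \<notin> (\<lambda>u. - ln u) ` (Z \<inter> {0<..})"
      by (auto simp: negligible_iff_null_sets intro: AE_not_in)
    then have "AE x in lborel. x \<notin> (\<lambda>u. - ln u) ` (Z \<inter> {0<..})"
      by (simp add: AE_completion_iff)
    then show ?thesis
    proof (rule AE_mp, intro AE_I2 impI notI)
      fix x :: real assume "x \<notin> (\<lambda>u. - ln u) ` (Z \<inter> {0<..})" "exp (- x) \<in> Z"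
      then show False by (metis (no_types, lifting) IntI exp_gt_zero greaterThan_iff imageI ln_exp minus_minus)
    qed
  qed
  have "(\<lambda>n. integral\<^sup>L half_line (\<lambda>x. (E n x - h x)\<^sup>2)) \<longlonglongrightarrow> integral\<^sup>L half_line (\<lambda>x. 0)"
  proof (rule integral_dominated_convergence)
    show "integrable half_line (\<lambda>x. (2 * K + 1)\<^sup>2 * (exp (- 1 * x))\<^sup>2)"
      using square_integrable_exp[of 1] by (auto simp: square_integrable_half_line_def)
    show "AE x in half_line. norm ((E n x - h x)\<^sup>2) \<le> (2 * K + 1)\<^sup>2 * (exp (- 1 * x))\<^sup>2" for n
      unfolding AE_half_line
    proof (intro AE_I2 impI)
      fix x :: real assume x: "0 \<le> x"
      have "\<bar>p n (exp (- x)) - H (exp (- x))\<bar> \<le> 2 * K + 1"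
        using pK[of "exp (- x)" n] HK[of "exp (- x)"] x by auto
      then have "(p n (exp (- x)) - H (exp (- x)))\<^sup>2 \<le> (2 * K + 1)\<^sup>2"
        using abs_le_square_iff[of "p n (exp (- x)) - H (exp (- x))" "2 * K + 1"] K0 by simp
      moreover have "E n x - h x = exp (- x) * (p n (exp (- x)) - H (exp (- x)))"
        by (simp add: E_def hu[OF x] right_diff_distrib)
      ultimately show "norm ((E n x - h x)\<^sup>2) \<le> (2 * K + 1)\<^sup>2 * (exp (- 1 * x))\<^sup>2"
        by (simp add: power_mult_distrib mult.commute)
    qed
    show "AE x in half_line. (\<lambda>n. (E n x - h x)\<^sup>2) \<longlonglongrightarrow> 0"
      unfolding AE_half_line using AEZ
    proof (rule AE_mp, intro AE_I2 impI)
      fix x :: real assume z: "exp (- x) \<notin> Z" and x: "0 \<le> x"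
      have "(\<lambda>n. (E n x - h x)\<^sup>2) \<longlonglongrightarrow> (exp (- x) * H (exp (- x)) - h x)\<^sup>2"
        unfolding E_def using x by (intro tendsto_intros pH z) auto
      then show "(\<lambda>n. (E n x - h x)\<^sup>2) \<longlonglongrightarrow> 0" using hu[OF x] by simp
    qed
  qed (simp_all add: E_def)
  then have "(\<lambda>n. integral\<^sup>L half_line (\<lambda>x. (E n x - h x)\<^sup>2)) \<longlonglongrightarrow> 0" by simp
  then have "\<forall>\<^sub>F n in sequentially. integral\<^sup>L half_line (\<lambda>x. (E n x - h x)\<^sup>2) < e"
    using e by (rule order_tendstoD(2))
  then obtain n where n: "integral\<^sup>L half_line (\<lambda>x. (E n x - h x)\<^sup>2) < e"
    by (auto simp: eventually_sequentially)
  obtain c m where cm: "p n = (\<lambda>u. \<Sum>i\<le>m. c i * u ^ i)"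
    using pp[of n] by (auto simp: real_polynomial_function_iff_sum)
  have "E n x = (\<Sum>i\<le>m. c i * exp (- real (Suc i) * x))" for x
  proof -
    have *: "exp (- x) * (c i * exp (- x) ^ i) = c i * exp (- real (Suc i) * x)" for i
      by (simp add: exp_of_nat_mult[symmetric] exp_add[symmetric] algebra_simps)
    show ?thesis by (simp only: E_def cm sum_distrib_left *)
  qed
  then show ?thesis using n by auto
qed

theorem parseval_laguerre:
  fixes h :: "real \<Rightarrow> real"
  assumes h [measurable]: "h \<in> borel_measurable borel"
    and bnd: "\<And>x. \<bar>h x\<bar> \<le> B" and supp: "\<And>x. x \<notin> {0..b} \<Longrightarrow> h x = 0"
  shows "square_integrable_half_line h"
    and "(\<lambda>l. (half_line_coeff h l)\<^sup>2) sums integral\<^sup>L half_line (\<lambda>x. (h x)\<^sup>2)"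
proof -
  have hB: "(h x)\<^sup>2 \<le> B\<^sup>2" for x
    using bnd[of x] abs_ge_zero[of "h x"] power_mono[of "\<bar>h x\<bar>" B 2] by simp
  have "integrable lborel (\<lambda>x. indicator {0..b} x *\<^sub>R (h x)\<^sup>2)"
    by (rule integrableI_bounded_set_indicator[where B = "B\<^sup>2"])
      (auto simp: emeasure_lborel_Icc_eq hB)
  then have "integrable lborel (\<lambda>x. indicator {0..b} x * (h x)\<^sup>2)" by simp
  moreover have "(\<lambda>x. indicat_real {0..} x * (h x)\<^sup>2) = (\<lambda>x. indicator {0..b} x * (h x)\<^sup>2)"
    using supp by (fastforce simp: indicator_def)
  ultimately show sq: "square_integrable_half_line h"
    by (simp add: square_integrable_half_line_def integrable_half_line)
  show "(\<lambda>l. (half_line_coeff h l)\<^sup>2) sums integral\<^sup>L half_line (\<lambda>x. (h x)\<^sup>2)"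
  proof (rule parseval_laguerre_if_approximable[OF sq])
    fix e :: real assume e: "0 < e"
    then have e4: "0 < e / 4" by simp
    have "\<exists>m c. integral\<^sup>L half_line
        (\<lambda>x. ((\<Sum>i\<le>m. c i * exp (- real (Suc i) * x)) - h x)\<^sup>2) < e / 4"
      by (rule exp_sums_dense[OF h bnd _ e4]) (rule supp)
    then obtain m c where mc: "integral\<^sup>L half_line
        (\<lambda>x. ((\<Sum>i\<le>m. c i * exp (- real (Suc i) * x)) - h x)\<^sup>2) < e / 4"
      by blast
    obtain n a where na: "integral\<^sup>L half_line (\<lambda>x. ((\<Sum>l<n. a l * laguerre_fun l x)
             - (\<Sum>i\<le>m. c i * exp (- real (Suc i) * x)))\<^sup>2) < e / 4"
      using exp_sum_approximable[OF e4] by blast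
    define S where "S x = (\<Sum>l<n. a l * laguerre_fun l x)" for x
    define E where "E x = (\<Sum>i\<le>m. c i * exp (- real (Suc i) * x))" for x
    have S: "square_integrable_half_line S"
      unfolding S_def[abs_def] by (rule square_integrable_laguerre_sum)
    have E: "square_integrable_half_line E"
      unfolding E_def[abs_def]
      by (intro square_integrable_half_line_sum square_integrable_half_line_scale square_integrable_exp) simp
    have int: "integrable half_line (\<lambda>x. (S x - E x)\<^sup>2)" "integrable half_line (\<lambda>x. (E x - h x)\<^sup>2)"
      "integrable half_line (\<lambda>x. (S x - h x)\<^sup>2)"
      using square_integrable_half_line_diff[OF S E] square_integrable_half_line_diff[OF E sq]
        square_integrable_half_line_diff[OF S sq] by (simp_all add: square_integrable_half_line_def)
    have "integral\<^sup>L half_line (\<lambda>x. (S x - h x)\<^sup>2)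
        \<le> integral\<^sup>L half_line (\<lambda>x. 2 * (S x - E x)\<^sup>2 + 2 * (E x - h x)\<^sup>2)"
    proof (rule integral_mono)
      show "(S x - h x)\<^sup>2 \<le> 2 * (S x - E x)\<^sup>2 + 2 * (E x - h x)\<^sup>2" for x
        using zero_le_power2[of "(S x - E x) - (E x - h x)"]
        by (simp add: power2_eq_square algebra_simps)
    qed (use int in auto)
    also have "\<dots> = 2 * integral\<^sup>L half_line (\<lambda>x. (S x - E x)\<^sup>2) + 2 * integral\<^sup>L half_line (\<lambda>x. (E x - h x)\<^sup>2)"
      using int by simp
    also have "\<dots> < e" using na mc by (simp add: S_def E_def)
    finally show "\<exists>n a. integral\<^sup>L half_line (\<lambda>x. ((\<Sum>l<n. a l * laguerre_fun l x) - h x)\<^sup>2) < e"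
      unfolding S_def by blast
  qed
qed

section \<open>Empirical coefficients\<close>

lemma (in prob_space) second_moment_sum_indep_centered:
  fixes Z :: "'i \<Rightarrow> 'a \<Rightarrow> real"
  assumes fin: "finite I" and indep: "indep_vars (\<lambda>_. borel) Z I"
    and mean: "\<And>i. i \<in> I \<Longrightarrow> expectation (Z i) = 0"
    and int: "\<And>i. i \<in> I \<Longrightarrow> integrable M (\<lambda>\<omega>. (Z i \<omega>)\<^sup>2)"
  shows "integrable M (\<lambda>\<omega>. (\<Sum>i\<in>I. Z i \<omega>)\<^sup>2)"
    and "expectation (\<lambda>\<omega>. (\<Sum>i\<in>I. Z i \<omega>)\<^sup>2) = (\<Sum>i\<in>I. expectation (\<lambda>\<omega>. (Z i \<omega>)\<^sup>2))"
proof -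
  have meas: "Z i \<in> borel_measurable M" if "i \<in> I" for i
    using indep that by (simp add: indep_vars_def)
  have int1: "integrable M (Z i)" if "i \<in> I" for i
    using square_integrable_imp_integrable[OF meas int] that by simp
  have prods: "integrable M (\<lambda>\<omega>. Z i \<omega> * Z j \<omega>) \<and>
      expectation (\<lambda>\<omega>. Z i \<omega> * Z j \<omega>) = of_bool (i = j) * expectation (\<lambda>\<omega>. (Z i \<omega>)\<^sup>2)"
    if ij: "i \<in> I" "j \<in> I" for i j
  proof (cases "i = j")
    case True
    then show ?thesis using int[OF ij(1)] by (simp add: power2_eq_square)
  next
    case False
    have ind: "indep_vars (\<lambda>_. borel) Z {i, j}"
      using ij by (intro indep_vars_subset[OF indep]) auto
    have int': "integrable M (Z l)" if "l \<in> {i, j}" for l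
      using that int1 ij by auto
    show ?thesis
      using indep_vars_lebesgue_integral[OF _ ind int'] indep_vars_integrable[OF _ ind int'] ij mean False
      by simp
  qed
  have eq: "(\<Sum>i\<in>I. Z i \<omega>)\<^sup>2 = (\<Sum>i\<in>I. \<Sum>j\<in>I. Z i \<omega> * Z j \<omega>)" for \<omega>
    by (simp add: power2_eq_square sum_product)
  show "integrable M (\<lambda>\<omega>. (\<Sum>i\<in>I. Z i \<omega>)\<^sup>2)"
    unfolding eq using prods by (intro Bochner_Integration.integrable_sum) simp
  have "expectation (\<lambda>\<omega>. (\<Sum>i\<in>I. Z i \<omega>)\<^sup>2)
      = (\<Sum>i\<in>I. \<Sum>j\<in>I. expectation (\<lambda>\<omega>. Z i \<omega> * Z j \<omega>))"
    unfolding eq using prods by simp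
  also have "\<dots> = (\<Sum>i\<in>I. \<Sum>j\<in>I. of_bool (i = j) * expectation (\<lambda>\<omega>. (Z i \<omega>)\<^sup>2))"
    using prods by (intro sum.cong refl) simp
  also have "\<dots> = (\<Sum>i\<in>I. expectation (\<lambda>\<omega>. (Z i \<omega>)\<^sup>2))"
    using fin by (simp add: of_bool_def if_distrib[of "\<lambda>x. x * _"] sum.If_cases)
  finally show "expectation (\<lambda>\<omega>. (\<Sum>i\<in>I. Z i \<omega>)\<^sup>2) = (\<Sum>i\<in>I. expectation (\<lambda>\<omega>. (Z i \<omega>)\<^sup>2))" .
qed

text \<open>Truncation at level \<open>c\<close> can only decrease the second moments, and it moves each mean by at
  most \<open>V / c\<close> because \<open>\<bar>X\<bar> \<le> X\<^sup>2 / c\<close> where \<open>\<bar>X\<bar> > c\<close>. No common distribution is needed.\<close>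

lemma (in prob_space) truncated_mean_risk:
  fixes X :: "nat \<Rightarrow> 'a \<Rightarrow> real"
  assumes indep: "indep_vars (\<lambda>_. borel) X UNIV"
    and int: "\<And>i. integrable M (\<lambda>\<omega>. (X i \<omega>)\<^sup>2)"
    and var: "\<And>i. expectation (\<lambda>\<omega>. (X i \<omega>)\<^sup>2) \<le> V"
    and mean: "\<And>i. expectation (X i) = \<mu>"
    and c: "0 < c" and n: "0 < n"
  shows "integrable M (\<lambda>\<omega>. ((1 / real n) * (\<Sum>i=1..n. X i \<omega> * of_bool (\<bar>X i \<omega>\<bar> \<le> c)) - \<mu>)\<^sup>2)"
    and "expectation (\<lambda>\<omega>. ((1 / real n) * (\<Sum>i=1..n. X i \<omega> * of_bool (\<bar>X i \<omega>\<bar> \<le> c)) - \<mu>)\<^sup>2)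
      \<le> 2 * V / real n + 2 * (V / c)\<^sup>2"
proof -
  have [measurable]: "X i \<in> borel_measurable M" for i
    using indep by (simp add: indep_vars_def)
  define Y where "Y i \<omega> = X i \<omega> * of_bool (\<bar>X i \<omega>\<bar> \<le> c)" for i \<omega>
  have [measurable]: "Y i \<in> borel_measurable M" for i
    unfolding Y_def[abs_def] by measurable
  have X1: "integrable M (X i)" for i
    using square_integrable_imp_integrable[OF _ int] by simp
  have Y2: "integrable M (\<lambda>\<omega>. (Y i \<omega>)\<^sup>2)" for i
    by (rule Bochner_Integration.integrable_bound[OF int[of i]]) (auto simp: Y_def)
  have Y1: "integrable M (Y i)" for i
    using square_integrable_imp_integrable[OF _ Y2] by simp
  have V: "expectation (\<lambda>\<omega>. (Y i \<omega>)\<^sup>2) \<le> V" for i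
    by (rule order_trans[OF integral_mono[OF Y2 int] var]) (auto simp: Y_def)
  define B where "B i = expectation (Y i)" for i
  define Z where "Z i \<omega> = Y i \<omega> - B i" for i \<omega>
  have Zind: "indep_vars (\<lambda>_. borel) Z {1..n}"
  proof -
    have "indep_vars (\<lambda>_. borel) (\<lambda>i \<omega>. (\<lambda>x. x * of_bool (\<bar>x\<bar> \<le> c) - B i) (X i \<omega>)) {1..n}"
      by (rule indep_vars_compose2[OF indep_vars_subset[OF indep]]) auto
    then show ?thesis by (simp add: Z_def[abs_def] Y_def)
  qed
  have Zmean: "expectation (Z i) = 0" for i
    using Y1 by (simp add: Z_def[abs_def] B_def prob_space)
  have Z2: "integrable M (\<lambda>\<omega>. (Z i \<omega>)\<^sup>2)" for i
    using Y1 Y2 by (simp add: Z_def power2_diff)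
  have ZV: "expectation (\<lambda>\<omega>. (Z i \<omega>)\<^sup>2) \<le> V" for i
  proof -
    have "expectation (\<lambda>\<omega>. (Z i \<omega>)\<^sup>2) = expectation (\<lambda>\<omega>. (Y i \<omega>)\<^sup>2) - (B i)\<^sup>2"
      unfolding Z_def B_def by (rule variance_eq[OF Y1 Y2])
    then show ?thesis using V[of i] zero_le_power2[of "B i"] by linarith
  qed
  have bias: "\<bar>B i - \<mu>\<bar> \<le> V / c" for i
  proof -
    have "B i - \<mu> = expectation (\<lambda>\<omega>. Y i \<omega> - X i \<omega>)"
      using X1 Y1 by (simp add: B_def mean)
    also have "\<bar>\<dots>\<bar> \<le> expectation (\<lambda>\<omega>. \<bar>Y i \<omega> - X i \<omega>\<bar>)"
      by (rule integral_abs_bound)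
    also have "\<dots> \<le> expectation (\<lambda>\<omega>. (X i \<omega>)\<^sup>2 / c)"
    proof (rule integral_mono)
      show "\<bar>Y i \<omega> - X i \<omega>\<bar> \<le> (X i \<omega>)\<^sup>2 / c" for \<omega>
      proof (cases "\<bar>X i \<omega>\<bar> \<le> c")
        case False
        then have "\<bar>X i \<omega>\<bar> * c \<le> \<bar>X i \<omega>\<bar> * \<bar>X i \<omega>\<bar>" by (intro mult_left_mono) auto
        then show ?thesis using False c by (simp add: Y_def power2_eq_square field_simps)
      qed (use c in \<open>simp add: Y_def\<close>)
    qed (use X1 Y1 int in auto)
    also have "\<dots> \<le> V / c"
      using var c by (simp add: divide_right_mono)
    finally show ?thesis .
  qed
  have eq: "(1 / real n) * (\<Sum>i=1..n. X i \<omega> * of_bool (\<bar>X i \<omega>\<bar> \<le> c)) - \<mu>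
      = (1 / real n) * (\<Sum>i=1..n. Z i \<omega>) + (1 / real n) * (\<Sum>i=1..n. B i - \<mu>)" for \<omega>
    using n by (simp add: Z_def Y_def sum_subtractf field_simps)
  have S: "integrable M (\<lambda>\<omega>. (\<Sum>i=1..n. Z i \<omega>)\<^sup>2)"
    "expectation (\<lambda>\<omega>. (\<Sum>i=1..n. Z i \<omega>)\<^sup>2) = (\<Sum>i=1..n. expectation (\<lambda>\<omega>. (Z i \<omega>)\<^sup>2))"
    using second_moment_sum_indep_centered[OF _ Zind Zmean Z2] by simp_all
  have S1: "integrable M (\<lambda>\<omega>. \<Sum>i=1..n. Z i \<omega>)"
    unfolding Z_def using Y1 by auto
  show int': "integrable M (\<lambda>\<omega>. ((1 / real n) * (\<Sum>i=1..n. X i \<omega> * of_bool (\<bar>X i \<omega>\<bar> \<le> c)) - \<mu>)\<^sup>2)"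
    unfolding eq using S S1 by (simp add: power2_sum power_mult_distrib power_divide)
  define d where "d = (1 / real n) * (\<Sum>i=1..n. B i - \<mu>)"
  have d: "\<bar>d\<bar> \<le> V / c"
  proof -
    have "\<bar>\<Sum>i=1..n. B i - \<mu>\<bar> \<le> (\<Sum>i=1..n. V / c)"
      by (rule order_trans[OF sum_abs sum_mono[OF bias]])
    then show ?thesis using n by (simp add: d_def field_simps abs_mult)
  qed
  have "expectation (\<lambda>\<omega>. ((1 / real n) * (\<Sum>i=1..n. X i \<omega> * of_bool (\<bar>X i \<omega>\<bar> \<le> c)) - \<mu>)\<^sup>2)
      \<le> expectation (\<lambda>\<omega>. 2 / (real n)\<^sup>2 * (\<Sum>i=1..n. Z i \<omega>)\<^sup>2 + 2 * d\<^sup>2)"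
  proof (rule integral_mono[OF int'])
    show "((1 / real n) * (\<Sum>i=1..n. X i \<omega> * of_bool (\<bar>X i \<omega>\<bar> \<le> c)) - \<mu>)\<^sup>2
        \<le> 2 / (real n)\<^sup>2 * (\<Sum>i=1..n. Z i \<omega>)\<^sup>2 + 2 * d\<^sup>2" for \<omega>
    proof -
      define s where "s = (1 / real n) * (\<Sum>i=1..n. Z i \<omega>)"
      have "(s + d)\<^sup>2 \<le> 2 * s\<^sup>2 + 2 * d\<^sup>2"
        using zero_le_power2[of "s - d"] by (simp add: power2_eq_square algebra_simps)
      also have "s\<^sup>2 = (\<Sum>i=1..n. Z i \<omega>)\<^sup>2 / (real n)\<^sup>2"
        by (simp add: s_def power_divide)
      finally show ?thesis unfolding eq s_def d_def by simp
    qed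
  qed (use S in simp)
  also have "\<dots> = 2 / (real n)\<^sup>2 * (\<Sum>i=1..n. expectation (\<lambda>\<omega>. (Z i \<omega>)\<^sup>2)) + 2 * d\<^sup>2"
    using S by (simp add: prob_space)
  also have "\<dots> \<le> 2 / (real n)\<^sup>2 * (real n * V) + 2 * (V / c)\<^sup>2"
  proof (intro add_mono mult_left_mono)
    show "(\<Sum>i=1..n. expectation (\<lambda>\<omega>. (Z i \<omega>)\<^sup>2)) \<le> real n * V"
      using sum_bounded_above[of "{1..n}" "\<lambda>i. expectation (\<lambda>\<omega>. (Z i \<omega>)\<^sup>2)" V] ZV by simp
    show "d\<^sup>2 \<le> (V / c)\<^sup>2"
      using d power_mono[OF d, of 2] by simp
  qed auto
  also have "2 / (real n)\<^sup>2 * (real n * V) = 2 * V / real n"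
    using n by (simp add: power2_eq_square)
  finally show "expectation (\<lambda>\<omega>. ((1 / real n) * (\<Sum>i=1..n. X i \<omega> * of_bool (\<bar>X i \<omega>\<bar> \<le> c)) - \<mu>)\<^sup>2)
      \<le> 2 * V / real n + 2 * (V / c)\<^sup>2" .
qed

context regression_model
begin

lemma density_measurable [measurable]: "g \<in> borel_measurable borel"
  using distributed_real_measurable[OF _ design] density_nonneg by simp

lemma random_variables [measurable]:
  "t i \<in> borel_measurable M" "\<epsilon> i \<in> borel_measurable M" "z i \<in> borel_measurable M"
  using distributed_measurable[OF design] distributed_measurable[OF noise_mult]
    distributed_measurable[OF noise_add] by simp_all

lemma indep_samples:
  fixes F :: "real \<Rightarrow> real \<Rightarrow> real \<Rightarrow> real"
  assumes F: "(\<lambda>(x, y, w). F x y w) \<in> borel_measurable (borel \<Otimes>\<^sub>M borel \<Otimes>\<^sub>M borel)"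
  shows "indep_vars (\<lambda>_. borel) (\<lambda>i \<omega>. F (t i \<omega>) (\<epsilon> i \<omega>) (z i \<omega>)) UNIV"
proof -
  \<comment> \<open>The three indices of the \<open>i\<close>-th observation; these blocks are disjoint.\<close>
  define K :: "nat \<Rightarrow> (nat + nat + nat) set" where "K i = {Inl i, Inr (Inl i), Inr (Inr i)}" for i
  have "indep_vars (\<lambda>i. PiM (K i) (\<lambda>_. borel))
      (\<lambda>i \<omega>. restrict (\<lambda>j. case_sum t (case_sum \<epsilon> z) j \<omega>) (K i)) UNIV"
    by (rule indep_vars_restrict[OF independent]) (auto simp: disjoint_family_on_def K_def)
  then have "indep_vars (\<lambda>_. borel) (\<lambda>i \<omega>. (\<lambda>w. F (w (Inl i)) (w (Inr (Inl i))) (w (Inr (Inr i))))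
      (restrict (\<lambda>j. case_sum t (case_sum \<epsilon> z) j \<omega>) (K i))) UNIV"
  proof (rule indep_vars_compose2)
    fix i
    have "(\<lambda>w. (w (Inl i), w (Inr (Inl i)), w (Inr (Inr i))))
        \<in> PiM (K i) (\<lambda>_. borel) \<rightarrow>\<^sub>M (borel \<Otimes>\<^sub>M borel \<Otimes>\<^sub>M (borel :: real measure))"
      by (intro measurable_Pair measurable_component_singleton) (auto simp: K_def)
    from measurable_compose[OF this F]
    show "(\<lambda>w. F (w (Inl i)) (w (Inr (Inl i))) (w (Inr (Inr i)))) \<in> PiM (K i) (\<lambda>_. borel) \<rightarrow>\<^sub>M borel"
      by simp
  qed
  then show ?thesis by (simp add: K_def)
qed

lemma expectation_product:
  fixes u p q :: "real \<Rightarrow> real"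
  assumes [measurable]: "u \<in> borel_measurable borel" "p \<in> borel_measurable borel" "q \<in> borel_measurable borel"
    and int: "has_bochner_integral M (\<lambda>\<omega>. u (t i \<omega>)) c\<^sub>1" "has_bochner_integral M (\<lambda>\<omega>. p (\<epsilon> i \<omega>)) c\<^sub>2"
      "has_bochner_integral M (\<lambda>\<omega>. q (z i \<omega>)) c\<^sub>3"
  shows "has_bochner_integral M (\<lambda>\<omega>. u (t i \<omega>) * p (\<epsilon> i \<omega>) * q (z i \<omega>)) (c\<^sub>1 * c\<^sub>2 * c\<^sub>3)"
proof -
  let ?Y = "case_sum (\<lambda>_::nat. u) (case_sum (\<lambda>_::nat. p) (\<lambda>_::nat. q))"
  let ?I = "{Inl i, Inr (Inl i), Inr (Inr i)} :: (nat + nat + nat) set"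
  have ind: "indep_vars (\<lambda>_. borel) (\<lambda>j \<omega>. ?Y j (case_sum t (case_sum \<epsilon> z) j \<omega>)) ?I"
    by (rule indep_vars_compose2[OF indep_vars_subset[OF independent]]) (auto split: sum.split)
  have int': "integrable M (\<lambda>\<omega>. ?Y j (case_sum t (case_sum \<epsilon> z) j \<omega>))" if "j \<in> ?I" for j
    using that int[THEN integrable.intros] by auto
  show ?thesis
    using indep_vars_lebesgue_integral[OF _ ind int'] indep_vars_integrable[OF _ ind int']
      int[THEN has_bochner_integral_integral_eq]
    by (simp add: has_bochner_integral_iff mult.assoc)
qed

lemma noise_moments:
  assumes X: "distributed M lborel X std_normal_density"
  shows "has_bochner_integral M X 0" "has_bochner_integral M (\<lambda>\<omega>. (X \<omega>)\<^sup>2) 1"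
    "has_bochner_integral M (\<lambda>\<omega>. (X \<omega>) ^ 4) 3"
proof -
  have *: "has_bochner_integral M (\<lambda>\<omega>. (X \<omega>) ^ k) c"
    if "has_bochner_integral lborel (\<lambda>x. std_normal_density x * x ^ k) c" for k c
    using that distributed_integral[OF X, of "\<lambda>x. x ^ k"] distributed_integrable[OF X, of "\<lambda>x. x ^ k"]
    by (simp add: has_bochner_integral_iff)
  show "has_bochner_integral M X 0"
    using *[OF std_normal_moment_odd[of 0]] by simp
  show "has_bochner_integral M (\<lambda>\<omega>. (X \<omega>)\<^sup>2) 1"
    using *[OF std_normal_moment_even[of 1]] by simp
  show "has_bochner_integral M (\<lambda>\<omega>. (X \<omega>) ^ 4) 3"
    using *[OF std_normal_moment_even[of 2]] by (simp add: fact_numeral)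
qed

lemma AE_design: "AE \<omega> in M. t i \<omega> \<in> {0..<b}"
proof -
  have "AE x in density lborel g. x \<in> {0..<b}"
  proof (subst AE_density)
    show "AE x in lborel. 0 < ennreal (g x) \<longrightarrow> x \<in> {0..<b}"
      using AE_lborel_singleton[of b]
    proof (rule AE_mp, intro AE_I2 impI)
      fix x assume "x \<noteq> b" "0 < ennreal (g x)"
      then show "x \<in> {0..<b}" using density_support[of x] by (cases "x \<in> {0..b}") auto
    qed
  qed simp
  then have "AE x in distr M lborel (t i). x \<in> {0..<b}"
    unfolding distributed_distr_eq_density[OF design] .
  then show ?thesis by (subst (asm) AE_distr_iff) auto
qed

text \<open>Division by the design density makes the mean of a function of a design point an unweighted
  integral. The bounds on \<open>g\<close> and \<open>u\<close> at the endpoint \<open>b\<close> are not needed, this being a null set.\<close>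

lemma expectation_design_ratio:
  fixes u :: "real \<Rightarrow> real"
  assumes [measurable]: "u \<in> borel_measurable borel"
    and g_lower: "\<forall>x\<in>{0..<b}. m \<le> g x" and m: "0 < m"
    and u_bound: "\<forall>x\<in>{0..<b}. \<bar>u x\<bar> \<le> B"
  shows "has_bochner_integral M (\<lambda>\<omega>. u (t i \<omega>) / g (t i \<omega>)) (LINT x:{0..b}|lborel. u x)"
proof -
  note g = bspec[OF g_lower] and u = bspec[OF u_bound]
  have "integrable M (\<lambda>\<omega>. u (t i \<omega>) / g (t i \<omega>))"
  proof (rule integrable_const_bound[of _ "B / m"])
    show "AE \<omega> in M. norm (u (t i \<omega>) / g (t i \<omega>)) \<le> B / m"
      using AE_design[of i]
    proof (rule AE_mp, intro AE_I2 impI)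
      fix \<omega> assume *: "t i \<omega> \<in> {0..<b}"
      have "0 \<le> B" using u[OF *] by linarith
      then show "norm (u (t i \<omega>) / g (t i \<omega>)) \<le> B / m"
        using u[OF *] g[OF *] m density_nonneg[of "t i \<omega>"] by (simp add: frac_le)
    qed
  qed simp
  moreover have "expectation (\<lambda>\<omega>. u (t i \<omega>) / g (t i \<omega>)) = (LINT x:{0..b}|lborel. u x)"
  proof -
    have "expectation (\<lambda>\<omega>. u (t i \<omega>) / g (t i \<omega>)) = (\<integral>x. g x * (u x / g x) \<partial>lborel)"
      using distributed_integral[OF design, of "\<lambda>x. u x / g x"] density_nonneg by simp
    also have "\<dots> = (LINT x:{0..b}|lborel. u x)"
      unfolding set_lebesgue_integral_def
    proof (rule integral_cong_AE)
      show "AE x in lborel. g x * (u x / g x) = indicat_real {0..b} x *\<^sub>R u x"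
        using AE_lborel_singleton[of b]
      proof (rule AE_mp, intro AE_I2 impI)
        fix x assume "x \<noteq> b"
        then show "g x * (u x / g x) = indicat_real {0..b} x *\<^sub>R u x"
          using g[of x] m density_support[of x] by (cases "x \<in> {0..b}") auto
      qed
    qed auto
    finally show ?thesis .
  qed
  ultimately show ?thesis by (simp add: has_bochner_integral_iff)
qed

end

text \<open>Each summand of the coefficient estimator is, before truncation, an unbiased estimate of the
  Laguerre coefficient of \<open>f\<^sup>2\<close>, and its second moment is bounded uniformly in \<open>f\<close>. The constants use
  \<open>E \<epsilon>\<^sup>4 = 3\<close> and \<open>(p + q)\<^sup>2 \<le> 2 p\<^sup>2 + 2 q\<^sup>2\<close> (three times).\<close>

lemma (in regression_model) coeff_term_moments:
  fixes f :: "real \<Rightarrow> real"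
  assumes f [measurable]: "f \<in> borel_measurable borel"
    and f_bound: "\<forall>x\<in>{0..<b}. \<bar>f x\<bar> \<le> B"
    and g_lower: "\<forall>x\<in>{0..<b}. m \<le> g x" and m: "0 < m"
    and laguerre_bound: "\<forall>x\<in>{0..<b}. \<bar>laguerre_fun k x\<bar> \<le> L"
  defines "X \<equiv> \<lambda>i \<omega>. coeff_term b \<sigma> g k (t i \<omega>) (observation f \<sigma> t \<epsilon> z i \<omega>)"
    and "I \<equiv> LINT u:{0..b}|lborel. laguerre_fun k u"
  shows "expectation (X i) = laguerre_coeff b (square_ext b f) k"
    and "integrable M (\<lambda>\<omega>. (X i \<omega>)\<^sup>2)"
    and "expectation (\<lambda>\<omega>. (X i \<omega>)\<^sup>2) \<le> 48 * (L / m)\<^sup>2 * (B ^ 4 + \<sigma> ^ 4) + 2 * \<sigma> ^ 4 * I\<^sup>2"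
proof -
  note fB = bspec[OF f_bound] and g = bspec[OF g_lower] and L = bspec[OF laguerre_bound]
  have b0: "0 \<in> {0..<b}" using b_pos by simp
  have L0: "0 \<le> L" using L[OF b0] by linarith
  have B0: "0 \<le> B" using fB[OF b0] by linarith
  have f2: "(f x)\<^sup>2 \<le> B\<^sup>2" if "x \<in> {0..<b}" for x
    using fB[OF that] power_mono[of "\<bar>f x\<bar>" B 2] by simp
  have u1: "\<forall>x\<in>{0..<b}. \<bar>(f x)\<^sup>2 * laguerre_fun k x\<bar> \<le> B\<^sup>2 * L"
    unfolding abs_mult using f2 L B0 by (intro ballI mult_mono) auto
  have u2: "\<forall>x\<in>{0..<b}. \<bar>f x * laguerre_fun k x\<bar> \<le> B * L"
    unfolding abs_mult using fB L B0 by (intro ballI mult_mono) auto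
  have E1: "has_bochner_integral M (\<lambda>\<omega>. (f (t i \<omega>))\<^sup>2 * laguerre_fun k (t i \<omega>) / g (t i \<omega>))
      (laguerre_coeff b (square_ext b f) k)"
  proof -
    have "(LINT x:{0..b}|lborel. (f x)\<^sup>2 * laguerre_fun k x) = laguerre_coeff b (square_ext b f) k"
      unfolding laguerre_coeff_def by (rule set_lebesgue_integral_cong) (auto simp: square_ext_def)
    moreover have "has_bochner_integral M (\<lambda>\<omega>. (f (t i \<omega>))\<^sup>2 * laguerre_fun k (t i \<omega>) / g (t i \<omega>))
        (LINT x:{0..b}|lborel. (f x)\<^sup>2 * laguerre_fun k x)"
      by (rule expectation_design_ratio[OF _ g_lower m u1]) measurable
    ultimately show ?thesis by simp
  qed
  have E2: "has_bochner_integral M (\<lambda>\<omega>. f (t i \<omega>) * laguerre_fun k (t i \<omega>) / g (t i \<omega>))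
      (LINT x:{0..b}|lborel. f x * laguerre_fun k x)"
    by (rule expectation_design_ratio[OF _ g_lower m u2]) measurable
  have E3: "has_bochner_integral M (\<lambda>\<omega>. laguerre_fun k (t i \<omega>) / g (t i \<omega>)) I"
    unfolding I_def by (rule expectation_design_ratio[OF _ g_lower m laguerre_bound]) measurable
  have one: "has_bochner_integral M (\<lambda>_. c) c" for c :: real
    by (simp add: has_bochner_integral_iff prob_space)
  note \<epsilon> = noise_moments[OF noise_mult, of i] and z = noise_moments[OF noise_add, of i]
  have "has_bochner_integral M
      (\<lambda>\<omega>. (f (t i \<omega>))\<^sup>2 * laguerre_fun k (t i \<omega>) / g (t i \<omega>) * (\<epsilon> i \<omega>)\<^sup>2 * 1)
      (laguerre_coeff b (square_ext b f) k * 1 * 1)"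
    by (rule expectation_product[OF _ _ _ E1 \<epsilon>(2) one]) measurable
  then have P1: "has_bochner_integral M
      (\<lambda>\<omega>. (f (t i \<omega>))\<^sup>2 * laguerre_fun k (t i \<omega>) / g (t i \<omega>) * (\<epsilon> i \<omega>)\<^sup>2)
      (laguerre_coeff b (square_ext b f) k)" by simp
  have "has_bochner_integral M
      (\<lambda>\<omega>. f (t i \<omega>) * laguerre_fun k (t i \<omega>) / g (t i \<omega>) * \<epsilon> i \<omega> * z i \<omega>)
      ((LINT x:{0..b}|lborel. f x * laguerre_fun k x) * 0 * 0)"
    by (rule expectation_product[OF _ _ _ E2 \<epsilon>(1) z(1)]) measurable
  then have P2: "has_bochner_integral M
      (\<lambda>\<omega>. f (t i \<omega>) * laguerre_fun k (t i \<omega>) / g (t i \<omega>) * \<epsilon> i \<omega> * z i \<omega>) 0" by simp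
  have "has_bochner_integral M
      (\<lambda>\<omega>. laguerre_fun k (t i \<omega>) / g (t i \<omega>) * 1 * (z i \<omega>)\<^sup>2) (I * 1 * 1)"
    by (rule expectation_product[OF _ _ _ E3 one z(2)]) measurable
  then have P3: "has_bochner_integral M
      (\<lambda>\<omega>. laguerre_fun k (t i \<omega>) / g (t i \<omega>) * (z i \<omega>)\<^sup>2) I" by simp
  have "has_bochner_integral M (\<lambda>\<omega>.
      (f (t i \<omega>))\<^sup>2 * laguerre_fun k (t i \<omega>) / g (t i \<omega>) * (\<epsilon> i \<omega>)\<^sup>2
      + 2 * \<sigma> * (f (t i \<omega>) * laguerre_fun k (t i \<omega>) / g (t i \<omega>) * \<epsilon> i \<omega> * z i \<omega>)
      + \<sigma>\<^sup>2 * (laguerre_fun k (t i \<omega>) / g (t i \<omega>) * (z i \<omega>)\<^sup>2) - \<sigma>\<^sup>2 * I)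
      (laguerre_coeff b (square_ext b f) k + 2 * \<sigma> * 0 + \<sigma>\<^sup>2 * I - \<sigma>\<^sup>2 * I)"
    by (intro has_bochner_integral_add has_bochner_integral_diff has_bochner_integral_mult_right P1 P2 P3 one)
  also have "(\<lambda>\<omega>. (f (t i \<omega>))\<^sup>2 * laguerre_fun k (t i \<omega>) / g (t i \<omega>) * (\<epsilon> i \<omega>)\<^sup>2
      + 2 * \<sigma> * (f (t i \<omega>) * laguerre_fun k (t i \<omega>) / g (t i \<omega>) * \<epsilon> i \<omega> * z i \<omega>)
      + \<sigma>\<^sup>2 * (laguerre_fun k (t i \<omega>) / g (t i \<omega>) * (z i \<omega>)\<^sup>2) - \<sigma>\<^sup>2 * I) = X i"
    by (rule ext) (simp add: X_def coeff_term_def observation_def I_def power2_eq_square divide_inverse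
        algebra_simps)
  finally show "expectation (X i) = laguerre_coeff b (square_ext b f) k"
    by (simp add: has_bochner_integral_integral_eq)
  define W where "W \<omega> = 16 * (L / m)\<^sup>2 * (B ^ 4 * (\<epsilon> i \<omega>) ^ 4 + \<sigma> ^ 4 * (z i \<omega>) ^ 4) + 2 * \<sigma> ^ 4 * I\<^sup>2" for \<omega>
  have W: "integrable M W"
    unfolding W_def[abs_def] using \<epsilon>(3)[THEN integrable.intros] z(3)[THEN integrable.intros] by auto
  have EW: "expectation W = 48 * (L / m)\<^sup>2 * (B ^ 4 + \<sigma> ^ 4) + 2 * \<sigma> ^ 4 * I\<^sup>2"
    unfolding W_def[abs_def]
    using \<epsilon>(3)[THEN integrable.intros] z(3)[THEN integrable.intros]
      \<epsilon>(3)[THEN has_bochner_integral_integral_eq] z(3)[THEN has_bochner_integral_integral_eq]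
    by (simp add: prob_space algebra_simps)
  have XW: "AE \<omega> in M. (X i \<omega>)\<^sup>2 \<le> W \<omega>"
    using AE_design[of i]
  proof (rule AE_mp, intro AE_I2 impI)
    fix \<omega> assume t: "t i \<omega> \<in> {0..<b}"
    define y where "y = f (t i \<omega>) * \<epsilon> i \<omega> + \<sigma> * z i \<omega>"
    define r where "r = laguerre_fun k (t i \<omega>) / g (t i \<omega>)"
    have sq: "(p + q)\<^sup>2 \<le> 2 * p\<^sup>2 + 2 * q\<^sup>2" for p q :: real
      using zero_le_power2[of "p - q"] by (simp add: power2_eq_square algebra_simps)
    have p4: "p ^ 4 = (p\<^sup>2)\<^sup>2" for p :: real by (simp add: power_mult[symmetric])
    have "\<bar>r\<bar> \<le> L / m"
      using L[OF t] g[OF t] m density_nonneg[of "t i \<omega>"] L0 by (simp add: r_def frac_le)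
    then have r: "r\<^sup>2 \<le> (L / m)\<^sup>2" using power_mono[of "\<bar>r\<bar>" "L / m" 2] by simp
    have "(f (t i \<omega>)) ^ 4 \<le> B ^ 4" using fB[OF t] power_mono[of "\<bar>f (t i \<omega>)\<bar>" B 4] by simp
    then have fe: "(f (t i \<omega>) * \<epsilon> i \<omega>) ^ 4 \<le> B ^ 4 * (\<epsilon> i \<omega>) ^ 4"
      by (simp add: power_mult_distrib mult_right_mono)
    have "y ^ 4 \<le> (2 * (f (t i \<omega>) * \<epsilon> i \<omega>)\<^sup>2 + 2 * (\<sigma> * z i \<omega>)\<^sup>2)\<^sup>2"
      unfolding p4 y_def by (rule power_mono[OF sq]) simp
    also have "\<dots> \<le> 2 * (2 * (f (t i \<omega>) * \<epsilon> i \<omega>)\<^sup>2)\<^sup>2 + 2 * (2 * (\<sigma> * z i \<omega>)\<^sup>2)\<^sup>2"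
      by (rule sq)
    also have "\<dots> = 8 * (f (t i \<omega>) * \<epsilon> i \<omega>) ^ 4 + 8 * (\<sigma> ^ 4 * (z i \<omega>) ^ 4)"
      by (simp add: power_mult_distrib flip: power_mult)
    finally have y: "y ^ 4 \<le> 8 * (B ^ 4 * (\<epsilon> i \<omega>) ^ 4 + \<sigma> ^ 4 * (z i \<omega>) ^ 4)"
      using fe unfolding distrib_left by linarith
    have "(X i \<omega>)\<^sup>2 = (y\<^sup>2 * r + - (\<sigma>\<^sup>2 * I))\<^sup>2"
      by (simp add: X_def coeff_term_def observation_def y_def r_def I_def)
    also have "\<dots> \<le> 2 * (y\<^sup>2 * r)\<^sup>2 + 2 * (- (\<sigma>\<^sup>2 * I))\<^sup>2" by (rule sq)
    also have "\<dots> = 2 * (r\<^sup>2 * y ^ 4) + 2 * \<sigma> ^ 4 * I\<^sup>2"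
      by (simp add: power_mult_distrib p4[symmetric] mult_ac)
    also have "r\<^sup>2 * y ^ 4 \<le> (L / m)\<^sup>2 * (8 * (B ^ 4 * (\<epsilon> i \<omega>) ^ 4 + \<sigma> ^ 4 * (z i \<omega>) ^ 4))"
      by (rule mult_mono[OF r y]) auto
    finally show "(X i \<omega>)\<^sup>2 \<le> W \<omega>" by (simp add: W_def algebra_simps)
  qed
  show X2: "integrable M (\<lambda>\<omega>. (X i \<omega>)\<^sup>2)"
  proof (rule Bochner_Integration.integrable_bound[OF W])
    show "(\<lambda>\<omega>. (X i \<omega>)\<^sup>2) \<in> borel_measurable M"
      unfolding X_def coeff_term_def observation_def by measurable
    show "AE \<omega> in M. norm ((X i \<omega>)\<^sup>2) \<le> norm (W \<omega>)"
      using XW by (rule AE_mp) (auto intro!: AE_I2)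
  qed
  show "expectation (\<lambda>\<omega>. (X i \<omega>)\<^sup>2) \<le> 48 * (L / m)\<^sup>2 * (B ^ 4 + \<sigma> ^ 4) + 2 * \<sigma> ^ 4 * I\<^sup>2"
    using integral_mono_AE[OF X2 W XW] EW by simp
qed

lemma (in regression_model) coeff_estimator_risk:
  fixes f :: "real \<Rightarrow> real"
  assumes f [measurable]: "f \<in> borel_measurable borel"
    and f_bound: "\<forall>x\<in>{0..<b}. \<bar>f x\<bar> \<le> B"
    and g_lower: "\<forall>x\<in>{0..<b}. m \<le> g x" and m: "0 < m"
    and laguerre_bound: "\<forall>x\<in>{0..<b}. \<bar>laguerre_fun k x\<bar> \<le> L"
    and n: "2 \<le> n"
  defines "V \<equiv> 48 * (L / m)\<^sup>2 * (B ^ 4 + \<sigma> ^ 4)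
      + 2 * \<sigma> ^ 4 * (LINT u:{0..b}|lborel. laguerre_fun k u)\<^sup>2"
    and "D \<equiv> \<lambda>\<omega>. coeff_estimator b \<sigma> g n (\<lambda>i. t i \<omega>) (\<lambda>i. observation f \<sigma> t \<epsilon> z i \<omega>) k
      - laguerre_coeff b (square_ext b f) k"
  shows "integrable M (\<lambda>\<omega>. (D \<omega>)\<^sup>2)"
    and "expectation (\<lambda>\<omega>. (D \<omega>)\<^sup>2) \<le> 2 * V / real n + 2 * V\<^sup>2 * (ln (real n) / real n)"
proof -
  define X where "X i \<omega> = coeff_term b \<sigma> g k (t i \<omega>) (observation f \<sigma> t \<epsilon> z i \<omega>)" for i \<omega>
  define c where "c = sqrt (real n / ln (real n))"
  have ln0: "0 < ln (real n)" using n by simp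
  have c: "0 < c" using n ln0 by (simp add: c_def)
  have ind: "indep_vars (\<lambda>_. borel) X UNIV"
    unfolding X_def[abs_def] observation_def
    by (rule indep_samples[where F = "\<lambda>x y w. coeff_term b \<sigma> g k x (f x * y + \<sigma> * w)"])
      (simp add: coeff_term_def)
  note mom = coeff_term_moments[OF f f_bound g_lower m laguerre_bound, folded X_def V_def]
  have mean: "expectation (X i) = laguerre_coeff b (square_ext b f) k" for i
    using mom(1)[of i] by (simp add: X_def[abs_def])
  have D: "D \<omega> = (1 / real n) * (\<Sum>i=1..n. X i \<omega> * of_bool (\<bar>X i \<omega>\<bar> \<le> c))
      - laguerre_coeff b (square_ext b f) k" for \<omega>
    by (simp add: D_def coeff_estimator_def X_def c_def)
  note r = truncated_mean_risk[OF ind mom(2,3) mean c, of n]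
  show "integrable M (\<lambda>\<omega>. (D \<omega>)\<^sup>2)" unfolding D using r(1) n by simp
  have "c\<^sup>2 = real n / ln (real n)" using ln0 by (simp add: c_def)
  then have "2 * (V / c)\<^sup>2 = 2 * V\<^sup>2 * (ln (real n) / real n)"
    by (simp add: power_divide)
  then show "expectation (\<lambda>\<omega>. (D \<omega>)\<^sup>2) \<le> 2 * V / real n + 2 * V\<^sup>2 * (ln (real n) / real n)"
    unfolding D using r(2) n by simp
qed

section \<open>Hard thresholding of Sobolev sequences\<close>

text \<open>If the estimate \<open>x\<close> deviates from \<open>\<theta>\<close> by at most a fraction \<open>\<rho>\<close> of the threshold \<open>r\<close>, the
  thresholded estimate does as well, up to a constant, as the better of the two ideal choices:
  to estimate \<open>\<theta>\<close> by zero, or to pay the noise level \<open>r\<close>.\<close>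

lemma hard_threshold_error_good:
  fixes x \<theta> \<rho> r :: real
  assumes \<rho>: "0 < \<rho>" "\<rho> < 1" and l0: "0 \<le> r" and dev: "\<bar>x - \<theta>\<bar> \<le> \<rho> * r"
  shows "(x * of_bool (\<bar>x\<bar> > r) - \<theta>)\<^sup>2 \<le> 4 / (1 - \<rho>)\<^sup>2 * min (\<theta>\<^sup>2) (r\<^sup>2)"
proof -
  define e where "e = x * of_bool (\<bar>x\<bar> > r) - \<theta>"
  have \<rho>l: "\<rho> * r \<le> r" using \<rho> l0 mult_right_mono[of \<rho> 1 r] by simp
  have "(1 - \<rho>) * \<bar>e\<bar> \<le> 2 * \<bar>\<theta>\<bar> \<and> (1 - \<rho>) * \<bar>e\<bar> \<le> 2 * r"
  proof (cases "\<bar>x\<bar> > r")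
    case True
    then have e: "\<bar>e\<bar> \<le> \<rho> * r" using dev by (simp add: e_def)
    have "(1 - \<rho>) * \<bar>e\<bar> \<le> (1 - \<rho>) * r"
      using e \<rho>l \<rho> by (intro mult_left_mono) auto
    moreover have "(1 - \<rho>) * r \<le> \<bar>\<theta>\<bar>" using True dev by (simp add: left_diff_distrib)
    moreover have "(1 - \<rho>) * r \<le> r" using mult_nonneg_nonneg[of \<rho> r] \<rho> l0 by (simp add: left_diff_distrib)
    ultimately show ?thesis using l0 by linarith
  next
    case False
    then have e: "\<bar>e\<bar> = \<bar>\<theta>\<bar>" by (simp add: e_def)
    have "(1 - \<rho>) * \<bar>e\<bar> \<le> 1 * \<bar>e\<bar>" using \<rho> by (intro mult_right_mono) auto
    moreover have "\<bar>\<theta>\<bar> \<le> 2 * r" using False dev \<rho>l by linarith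
    ultimately show ?thesis unfolding e by linarith
  qed
  then have "((1 - \<rho>) * \<bar>e\<bar>)\<^sup>2 \<le> (2 * \<bar>\<theta>\<bar>)\<^sup>2 \<and> ((1 - \<rho>) * \<bar>e\<bar>)\<^sup>2 \<le> (2 * r)\<^sup>2"
    using \<rho> by (intro conjI power_mono) auto
  then have "(1 - \<rho>)\<^sup>2 * e\<^sup>2 \<le> 4 * min (\<theta>\<^sup>2) (r\<^sup>2)"
    by (simp add: power_mult_distrib min_def)
  then show ?thesis
    using \<rho> unfolding e_def[symmetric] by (simp add: field_simps)
qed

lemma hard_threshold_error_le:
  fixes x \<theta> r :: real
  shows "(x * of_bool (\<bar>x\<bar> > r) - \<theta>)\<^sup>2 \<le> 2 * (x - \<theta>)\<^sup>2 + 2 * r\<^sup>2"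
proof (cases "\<bar>x\<bar> > r")
  case False
  then have "x\<^sup>2 \<le> r\<^sup>2" using power_mono[of "\<bar>x\<bar>" r 2] by simp
  moreover have "\<theta>\<^sup>2 \<le> 2 * (x - \<theta>)\<^sup>2 + 2 * x\<^sup>2"
    using zero_le_power2[of "2 * x - \<theta>"] by (simp add: power2_eq_square algebra_simps)
  ultimately show ?thesis using False by simp
qed simp

text \<open>The last bound splits the sum at an arbitrary cutoff \<open>J \<ge> 1\<close>, where the first terms are bounded
  by \<open>q\<close> and the others by the tail of the ball.\<close>

lemma sobolev_sequence_bounds:
  fixes \<theta> :: "nat \<Rightarrow> real"
  assumes s: "0 \<le> s"
    and summ: "summable (\<lambda>l. max (real l) 1 powr (2 * s) * (\<theta> l)\<^sup>2)"
    and bnd: "(\<Sum>l. max (real l) 1 powr (2 * s) * (\<theta> l)\<^sup>2) \<le> A\<^sup>2"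
  shows "(\<theta> l)\<^sup>2 \<le> A\<^sup>2"
    and "1 \<le> J \<Longrightarrow> (\<Sum>l. (\<theta> (l + J))\<^sup>2) \<le> A\<^sup>2 * real J powr (- 2 * s)"
    and "1 \<le> J \<Longrightarrow> 0 \<le> q \<Longrightarrow>
      (\<Sum>l<n. min ((\<theta> l)\<^sup>2) q) \<le> real J * q + A\<^sup>2 * real J powr (- 2 * s)"
proof -
  define w where "w l = max (real l) 1 powr (2 * s) * (\<theta> l)\<^sup>2" for l
  have w0: "0 \<le> w l" for l by (simp add: w_def)
  have ws: "summable w" and wA: "suminf w \<le> A\<^sup>2" using summ bnd by (simp_all add: w_def[abs_def])
  have fin: "sum w F \<le> A\<^sup>2" if "finite F" for F
    using sum_le_suminf[OF ws that] w0 wA by (simp add: order_trans)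
  have w1: "(\<theta> l)\<^sup>2 \<le> w l" for l
  proof -
    have "1 \<le> max (real l) 1 powr (2 * s)" using s by (intro ge_one_powr_ge_zero) auto
    then have "1 * (\<theta> l)\<^sup>2 \<le> max (real l) 1 powr (2 * s) * (\<theta> l)\<^sup>2" by (rule mult_right_mono) simp
    then show ?thesis by (simp add: w_def)
  qed
  show "(\<theta> l)\<^sup>2 \<le> A\<^sup>2" using w1[of l] fin[of "{l}"] by simp
  have wJ: "(\<theta> l)\<^sup>2 \<le> real J powr (- 2 * s) * w l" if "1 \<le> J" "J \<le> l" for J l
  proof -
    have "real J powr (2 * s) \<le> max (real l) 1 powr (2 * s)"
      using that s by (intro powr_mono2) auto
    then have "real J powr (- 2 * s) * (real J powr (2 * s) * (\<theta> l)\<^sup>2) \<le> real J powr (- 2 * s) * w l"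
      unfolding w_def by (intro mult_left_mono mult_right_mono) auto
    moreover have "real J powr (- 2 * s) * real J powr (2 * s) = 1"
      using that by (simp add: powr_add[symmetric])
    ultimately show ?thesis by (simp add: mult.assoc[symmetric])
  qed
  show "(\<Sum>l. (\<theta> (l + J))\<^sup>2) \<le> A\<^sup>2 * real J powr (- 2 * s)" if J: "1 \<le> J"
  proof -
    have sJ: "summable (\<lambda>l. w (l + J))" using ws by (simp add: summable_iff_shift)
    have s2: "summable (\<lambda>l. (\<theta> (l + J))\<^sup>2)"
      by (rule summable_comparison_test'[OF sJ, of 0]) (simp add: w1)
    have "(\<Sum>l. (\<theta> (l + J))\<^sup>2) \<le> (\<Sum>l. real J powr (- 2 * s) * w (l + J))"
      using wJ[OF J] by (intro suminf_le s2 summable_mult sJ) simp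
    also have "\<dots> = real J powr (- 2 * s) * (\<Sum>l. w (l + J))"
      by (rule suminf_mult[OF sJ])
    also have "\<dots> \<le> real J powr (- 2 * s) * A\<^sup>2"
    proof (rule mult_left_mono)
      have "0 \<le> (\<Sum>l<J. w l)" by (intro sum_nonneg w0)
      then show "(\<Sum>l. w (l + J)) \<le> A\<^sup>2"
        using suminf_split_initial_segment[OF ws, of J] wA by linarith
    qed simp
    finally show ?thesis by (simp add: mult.commute)
  qed
  show "(\<Sum>l<n. min ((\<theta> l)\<^sup>2) q) \<le> real J * q + A\<^sup>2 * real J powr (- 2 * s)"
    if J: "1 \<le> J" and q: "0 \<le> q"
  proof -
    have "min ((\<theta> l)\<^sup>2) q \<le> q * of_bool (l < J) + real J powr (- 2 * s) * w l" for l
    proof (cases "l < J")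
      case True
      then show ?thesis using w0[of l] by (simp add: min.coboundedI2)
    next
      case False
      then show ?thesis using wJ[OF J, of l] by (simp add: min.coboundedI1)
    qed
    then have "(\<Sum>l<n. min ((\<theta> l)\<^sup>2) q)
        \<le> (\<Sum>l<n. q * of_bool (l < J) + real J powr (- 2 * s) * w l)"
      by (rule sum_mono)
    also have "\<dots> = q * real (card ({..<n} \<inter> {l. l < J})) + real J powr (- 2 * s) * (\<Sum>l<n. w l)"
      by (simp add: sum.distrib sum_distrib_left[symmetric])
    also have "\<dots> \<le> q * real J + real J powr (- 2 * s) * A\<^sup>2"
    proof (intro add_mono mult_left_mono)
      have "card ({..<n} \<inter> {l. l < J}) \<le> card {..<J}" by (rule card_mono) auto
      then show "real (card ({..<n} \<inter> {l. l < J})) \<le> real J" by simp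
    qed (use q fin in auto)
    finally show ?thesis by (simp add: mult.commute)
  qed
qed

section \<open>The risk bound\<close>

text \<open>By the truncation the estimators are bounded, whatever the observations.\<close>

lemma abs_coeff_estimator_le:
  "\<bar>coeff_estimator b \<sigma> g n x y k\<bar> \<le> sqrt (real n / ln (real n))"
proof (cases "n = 0")
  case False
  define c where "c = sqrt (real n / ln (real n))"
  define X where "X i = coeff_term b \<sigma> g k (x i) (y i)" for i
  have c0: "0 \<le> c" using False by (simp add: c_def)
  have "\<bar>\<Sum>i=1..n. X i * of_bool (\<bar>X i\<bar> \<le> c)\<bar> \<le> (\<Sum>i=1..n. c)"
    using c0 by (intro order_trans[OF sum_abs sum_mono]) auto
  then have "\<bar>(1 / real n) * (\<Sum>i=1..n. X i * of_bool (\<bar>X i\<bar> \<le> c))\<bar> \<le> c"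
    using False by (simp add: abs_mult field_simps)
  then show ?thesis by (simp add: coeff_estimator_def X_def c_def)
qed (simp add: coeff_estimator_def)

lemma laguerre_coeff_eq_half_line_coeff:
  assumes [measurable]: "h \<in> borel_measurable borel"
    and b: "\<And>x. x \<notin> {0..b} \<Longrightarrow> h x = 0"
  shows "laguerre_coeff b h k = half_line_coeff h k"
proof -
  have "indicat_real {0..b} x *\<^sub>R (h x * laguerre_fun k x) = indicat_real {0..} x * (h x * laguerre_fun k x)" for x
    using b[of x] by (auto simp: indicator_def)
  then show ?thesis
    unfolding laguerre_coeff_def half_line_coeff_def set_lebesgue_integral_def
    by (simp only: integral_half_line borel_measurable_times laguerre_fun_measurable assms(1))
qed

text \<open>The squared \<open>L\<^sup>2\<close> error of a linear combination of Laguerre functions in terms of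
  coefficients; equality of the tail rests on completeness.\<close>

lemma nn_integral_laguerre_sum_diff_square:
  fixes h :: "real \<Rightarrow> real"
  assumes h [measurable]: "h \<in> borel_measurable borel"
    and bnd: "\<And>x. \<bar>h x\<bar> \<le> B" and supp: "\<And>x. x \<notin> {0..b} \<Longrightarrow> h x = 0"
  shows "(\<integral>\<^sup>+u\<in>{0..}. ennreal (((\<Sum>l<n. a l * laguerre_fun l u) - h u)\<^sup>2) \<partial>lborel)
    = ennreal ((\<Sum>l<n. (a l - laguerre_coeff b h l)\<^sup>2) + (\<Sum>l. (laguerre_coeff b h (l + n))\<^sup>2))"
proof -
  have sq: "square_integrable_half_line h"
    using parseval_laguerre(1)[OF h bnd, of b] supp by blast
  have ps: "(\<lambda>l. (half_line_coeff h l)\<^sup>2) sums integral\<^sup>L half_line (\<lambda>x. (h x)\<^sup>2)"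
    using parseval_laguerre(2)[OF h bnd, of b] supp by blast
  have c: "laguerre_coeff b h l = half_line_coeff h l" for l
    by (rule laguerre_coeff_eq_half_line_coeff[OF h]) (rule supp)
  have "integral\<^sup>L half_line (\<lambda>x. (h x)\<^sup>2)
      = (\<Sum>l. (half_line_coeff h (l + n))\<^sup>2) + (\<Sum>l<n. (half_line_coeff h l)\<^sup>2)"
    using suminf_split_initial_segment[OF sums_summable[OF ps], of n] sums_unique[OF ps] by simp
  then have "integral\<^sup>L half_line (\<lambda>x. ((\<Sum>l<n. a l * laguerre_fun l x) - h x)\<^sup>2)
      = (\<Sum>l<n. (a l - laguerre_coeff b h l)\<^sup>2) + (\<Sum>l. (laguerre_coeff b h (l + n))\<^sup>2)"
    unfolding integral_laguerre_sum_diff_square[OF sq] c by simp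
  moreover have "integrable half_line (\<lambda>x. ((\<Sum>l<n. a l * laguerre_fun l x) - h x)\<^sup>2)"
    using square_integrable_half_line_diff[OF square_integrable_laguerre_sum sq]
    by (simp add: square_integrable_half_line_def)
  ultimately show ?thesis
    by (subst nn_integral_half_line[symmetric]) (auto simp: nn_integral_eq_integral)
qed

text \<open>The cutoff of order \<open>x powr (- 1 / (2 s + 1))\<close> balances the variance term \<open>J x\<close> against the
  squared bias \<open>J powr (- 2 s)\<close>.\<close>

lemma balanced_cutoff:
  fixes x s :: real
  assumes x: "0 < x" "x \<le> 1" and s: "0 \<le> s"
  shows "\<exists>J\<ge>1. real J * x \<le> 2 * x powr (2 * s / (2 * s + 1))
           \<and> real J powr (- 2 * s) \<le> x powr (2 * s / (2 * s + 1))"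
proof -
  define R where "R = x powr (- 1 / (2 * s + 1))"
  define J where "J = nat \<lceil>R\<rceil>"
  have "x powr 0 \<le> R"
    unfolding R_def by (rule powr_mono') (use x s in auto)
  then have R1: "1 \<le> R" using x by simp
  have JR: "R \<le> real J" "real J \<le> R + 1"
    unfolding J_def using R1 by linarith+
  have J1: "1 \<le> J" using R1 JR(1) by linarith
  have Rx: "R * x = x powr (2 * s / (2 * s + 1))"
  proof -
    have "R * x = R * x powr 1" using x by simp
    also have "\<dots> = x powr (- 1 / (2 * s + 1) + 1)"
      unfolding R_def by (rule powr_add[symmetric])
    also have "- 1 / (2 * s + 1) + 1 = 2 * s / (2 * s + 1)"
      using s by (simp add: field_simps)
    finally show ?thesis .
  qed
  have "real J * x \<le> (2 * R) * x"
    using JR(2) R1 x by (intro mult_right_mono) auto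
  then have "real J * x \<le> 2 * x powr (2 * s / (2 * s + 1))" by (simp only: mult.assoc Rx)
  moreover have "real J powr (- 2 * s) \<le> R powr (- 2 * s)"
    using JR(1) R1 s by (intro powr_mono2') auto
  then have "real J powr (- 2 * s) \<le> x powr (2 * s / (2 * s + 1))"
    by (simp add: R_def powr_powr)
  ultimately show ?thesis using J1 by blast
qed

text \<open>A bound for one sample size \<open>n\<close> and one \<open>f\<close>, with a constant that depends neither on \<open>n\<close> nor
  on \<open>f\<close>. The deviation inequality leaves out the index \<open>0\<close>; that coefficient is controlled by
  its second moment, with \<open>0 \<le> laguerre_fun 0 \<le> 1\<close> on \<open>[0, b)\<close>.\<close>

lemma (in regression_model) risk_le:
  fixes f :: "real \<Rightarrow> real" and A B K \<gamma> \<rho> \<tau> s :: real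
  assumes f: "f \<in> regression_class b B s A"
    and g_lower: "\<forall>x\<in>{0..<b}. m \<le> g x" and m: "0 < m"
    and s: "0 \<le> s" and \<rho>: "0 < \<rho>" "\<rho> < 1" and \<tau>: "3 \<le> \<tau>" and \<gamma>: "0 \<le> \<gamma>" and n: "3 \<le> n"
    and dev: "\<forall>l\<in>{1..n - 1}. prob {\<omega> \<in> space M.
          \<bar>coeff_estimator b \<sigma> g n (\<lambda>i. t i \<omega>) (\<lambda>i. observation f \<sigma> t \<epsilon> z i \<omega>) l
             - laguerre_coeff b (square_ext b f) l\<bar> > \<rho> * threshold \<gamma> n l}
        \<le> K * real n powr (- \<tau>)"
  defines "V \<equiv> 48 * (1 / m)\<^sup>2 * (B ^ 4 + \<sigma> ^ 4)
      + 2 * \<sigma> ^ 4 * (LINT u:{0..b}|lborel. laguerre_fun 0 u)\<^sup>2"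
    and "G \<equiv> 4 / (1 - \<rho>)\<^sup>2"
  shows "risk M b \<sigma> g t \<epsilon> z n n (threshold \<gamma> n) f
    \<le> ennreal ((4 * V + 4 * V\<^sup>2 + 2 * \<gamma>\<^sup>2 + G * (2 * \<gamma>\<^sup>2 + A\<^sup>2) + 2 * (1 + A\<^sup>2) * \<bar>K\<bar> + A\<^sup>2)
        * (ln (real n) / real n) powr (2 * s / (2 * s + 1)))"
proof -
  define h where "h = square_ext b f"
  define \<theta> where "\<theta> = laguerre_coeff b h"
  define est where "est l \<omega> = coeff_estimator b \<sigma> g n (\<lambda>i. t i \<omega>) (\<lambda>i. observation f \<sigma> t \<epsilon> z i \<omega>) l" for l \<omega>
  define r where "r = \<gamma> * sqrt (ln (real n)) / sqrt (real n)"
  define e where "e l \<omega> = est l \<omega> * of_bool (\<bar>est l \<omega>\<bar> > r) - \<theta> l" for l \<omega>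
  define T where "T = (\<Sum>l. (\<theta> (l + n))\<^sup>2)"
  define x where "x = ln (real n) / real n"
  define \<kappa> where "\<kappa> = 2 * s / (2 * s + 1)"
  define Q where "Q = 2 * real n + 2 * A\<^sup>2"

  have thr: "threshold \<gamma> n l = r" for l by (simp add: threshold_def r_def)
  have f_meas [measurable]: "f \<in> borel_measurable borel" and f_bound: "\<forall>x\<in>{0..<b}. \<bar>f x\<bar> \<le> B"
    and h_meas [measurable]: "h \<in> borel_measurable borel"
    and h_supp: "\<And>x. x \<notin> {0..b} \<Longrightarrow> h x = 0"
    and summ: "summable (\<lambda>l. max (real l) 1 powr (2 * s) * (\<theta> l)\<^sup>2)"
    and sA: "(\<Sum>l. max (real l) 1 powr (2 * s) * (\<theta> l)\<^sup>2) \<le> A\<^sup>2"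
    using f unfolding regression_class_def bounded_L2_def laguerre_sobolev_ball_def h_def \<theta>_def
    by auto
  note sobolev = sobolev_sequence_bounds[OF s summ sA]
  have h_bound: "\<bar>h x\<bar> \<le> max (B\<^sup>2) ((f b)\<^sup>2)" for x
  proof (cases "x \<in> {0..<b}")
    case True
    then have "(f x)\<^sup>2 \<le> B\<^sup>2" using f_bound power_mono[of "\<bar>f x\<bar>" B 2] by auto
    then show ?thesis using True by (simp add: h_def square_ext_def)
  next
    case False
    then show ?thesis by (cases "x = b") (auto simp: h_def square_ext_def le_max_iff_disj)
  qed

  have ln1: "1 \<le> ln (real n)"
  proof -
    have "exp 1 \<le> real n" using exp_le n by linarith
    then show ?thesis using n by (subst ln_ge_iff) auto
  qed
  have n0: "0 < real n" using n by simp
  have x0: "0 < x" unfolding x_def using ln1 n0 by (intro divide_pos_pos) linarith+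
  have x1: "x \<le> 1" using ln_le_minus_one[OF n0] n0 by (simp add: x_def)
  have nx: "1 / real n \<le> x" using ln1 n0 by (simp add: x_def divide_right_mono)
  have r2: "r\<^sup>2 = \<gamma>\<^sup>2 * x"
    using ln1 by (simp add: r_def x_def power_mult_distrib power_divide)
  have r0: "0 \<le> r" using \<gamma> ln1 by (simp add: r_def)
  have V0: "0 \<le> V" by (simp add: V_def)
  have G0: "0 \<le> G" by (simp add: G_def)
  have \<kappa>: "\<kappa> \<le> 1" "\<kappa> \<le> 2 * s"
    using s by (simp_all add: \<kappa>_def divide_le_eq mult_le_cancel_left1)
  have x\<kappa>: "x \<le> x powr \<kappa>"
    using powr_mono'[OF \<kappa>(1), of x] x0 x1 by simp

  have est_meas [measurable]: "est l \<in> borel_measurable M" for l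
    unfolding est_def[abs_def] coeff_estimator_def coeff_term_def observation_def by measurable
  have e_meas [measurable]: "e l \<in> borel_measurable M" for l
    unfolding e_def[abs_def] by measurable
  have eQ: "(e l \<omega>)\<^sup>2 \<le> Q" for l \<omega>
  proof -
    define y where "y = est l \<omega> * of_bool (\<bar>est l \<omega>\<bar> > r)"
    have "\<bar>est l \<omega>\<bar> \<le> sqrt (real n / ln (real n))"
      unfolding est_def by (rule abs_coeff_estimator_le)
    then have "(est l \<omega>)\<^sup>2 \<le> (sqrt (real n / ln (real n)))\<^sup>2"
      using power_mono[of "\<bar>est l \<omega>\<bar>" _ 2] by fastforce
    also have "\<dots> = real n / ln (real n)" using ln1 by simp
    also have "\<dots> \<le> real n" using ln1 n0 by (simp add: divide_le_eq)
    finally have "y\<^sup>2 \<le> real n" using n0 by (simp add: y_def)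
    moreover have "(\<theta> l)\<^sup>2 \<le> A\<^sup>2" by (rule sobolev)
    moreover have "(y - \<theta> l)\<^sup>2 \<le> 2 * y\<^sup>2 + 2 * (\<theta> l)\<^sup>2"
      using zero_le_power2[of "y + \<theta> l"] by (simp add: power2_eq_square algebra_simps)
    ultimately show ?thesis by (simp add: e_def Q_def y_def)
  qed
  have e_int: "integrable M (\<lambda>\<omega>. (e l \<omega>)\<^sup>2)" for l
    by (rule integrable_const_bound[of _ Q]) (auto simp: eQ)
  have T0: "0 \<le> T"
  proof -
    have "summable (\<lambda>l. (half_line_coeff h l)\<^sup>2)"
      using parseval_laguerre(2)[OF h_meas h_bound, of b] h_supp sums_summable by blast
    moreover have "half_line_coeff h l = \<theta> l" for l
      unfolding \<theta>_def by (rule laguerre_coeff_eq_half_line_coeff[symmetric, OF h_meas]) (rule h_supp)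
    ultimately have "summable (\<lambda>l. (\<theta> l)\<^sup>2)" by simp
    then show ?thesis
      unfolding T_def
      using summable_ignore_initial_segment[of "\<lambda>l. (\<theta> l)\<^sup>2" n] by (intro suminf_nonneg) simp_all
  qed

  have "risk M b \<sigma> g t \<epsilon> z n n (threshold \<gamma> n) f = (\<integral>\<^sup>+\<omega>. ennreal ((\<Sum>l<n. (e l \<omega>)\<^sup>2) + T) \<partial>M)"
    unfolding risk_def
  proof (rule nn_integral_cong)
    fix \<omega>
    show "(\<integral>\<^sup>+u\<in>{0..}. ennreal ((threshold_estimator b \<sigma> g n n (threshold \<gamma> n)
          (\<lambda>i. t i \<omega>) (\<lambda>i. observation f \<sigma> t \<epsilon> z i \<omega>) u - square_ext b f u)\<^sup>2) \<partial>lborel)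
      = ennreal ((\<Sum>l<n. (e l \<omega>)\<^sup>2) + T)"
      unfolding threshold_estimator_def thr est_def[symmetric] h_def[symmetric] e_def T_def \<theta>_def
      by (rule nn_integral_laguerre_sum_diff_square[OF h_meas h_bound]) (rule h_supp)
  qed
  also have "\<dots> = ennreal (expectation (\<lambda>\<omega>. (\<Sum>l<n. (e l \<omega>)\<^sup>2) + T))"
    using T0 by (intro nn_integral_eq_integral) (auto intro!: e_int add_nonneg_nonneg sum_nonneg)
  also have "expectation (\<lambda>\<omega>. (\<Sum>l<n. (e l \<omega>)\<^sup>2) + T) = (\<Sum>l<n. expectation (\<lambda>\<omega>. (e l \<omega>)\<^sup>2)) + T"
    using e_int by (simp add: prob_space)
  finally have risk_eq: "risk M b \<sigma> g t \<epsilon> z n n (threshold \<gamma> n) f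
      = ennreal ((\<Sum>l<n. expectation (\<lambda>\<omega>. (e l \<omega>)\<^sup>2)) + T)" .

  \<comment> \<open>The index \<open>0\<close>: a direct second moment bound.\<close>
  have E0: "expectation (\<lambda>\<omega>. (e 0 \<omega>)\<^sup>2) \<le> (4 * V + 4 * V\<^sup>2 + 2 * \<gamma>\<^sup>2) * x"
  proof -
    have L: "\<forall>x\<in>{0..<b}. \<bar>laguerre_fun 0 x\<bar> \<le> 1"
      by (auto simp: laguerre_fun_def laguerre_def)
    have n2: "2 \<le> n" using n by simp
    note R = coeff_estimator_risk[OF f_meas f_bound g_lower m L n2, folded V_def h_def est_def \<theta>_def]
    have "expectation (\<lambda>\<omega>. (e 0 \<omega>)\<^sup>2) \<le> expectation (\<lambda>\<omega>. 2 * (est 0 \<omega> - \<theta> 0)\<^sup>2 + 2 * r\<^sup>2)"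
      using R(1) by (intro integral_mono e_int) (auto simp: e_def hard_threshold_error_le)
    also have "\<dots> = 2 * expectation (\<lambda>\<omega>. (est 0 \<omega> - \<theta> 0)\<^sup>2) + 2 * r\<^sup>2"
      using R(1) by (simp add: prob_space)
    also have "\<dots> \<le> 2 * (2 * V / real n + 2 * V\<^sup>2 * x) + 2 * r\<^sup>2"
      using R(2) by (simp add: x_def)
    also have "2 * V / real n \<le> 2 * V * x"
      using mult_left_mono[OF nx, of "2 * V"] V0 by simp
    finally show ?thesis by (simp add: r2 algebra_simps)
  qed

  \<comment> \<open>The other indices: on the exceptional event \<open>S\<close> the squared error is at most \<open>Q\<close>, of order \<open>n\<close>.\<close>
  have El: "expectation (\<lambda>\<omega>. (e l \<omega>)\<^sup>2) \<le> G * min ((\<theta> l)\<^sup>2) (r\<^sup>2) + Q * (\<bar>K\<bar> * real n powr (- 3))"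
    if l: "l \<in> {1..n - 1}" for l
  proof -
    define S where "S = {\<omega> \<in> space M. \<bar>est l \<omega> - \<theta> l\<bar> > \<rho> * r}"
    have S [measurable]: "S \<in> sets M" unfolding S_def by measurable
    have Q0: "0 \<le> Q" by (simp add: Q_def)
    have S_int: "integrable M (indicat_real S)"
      by (rule integrable_const_bound[of _ 1]) auto
    have "expectation (\<lambda>\<omega>. (e l \<omega>)\<^sup>2)
        \<le> expectation (\<lambda>\<omega>. G * min ((\<theta> l)\<^sup>2) (r\<^sup>2) + Q * indicator S \<omega>)"
    proof (rule integral_mono[OF e_int])
      show "(e l \<omega>)\<^sup>2 \<le> G * min ((\<theta> l)\<^sup>2) (r\<^sup>2) + Q * indicator S \<omega>" if "\<omega> \<in> space M" for \<omega>
      proof (cases "\<omega> \<in> S")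
        case True
        have "0 \<le> G * min ((\<theta> l)\<^sup>2) (r\<^sup>2)" using G0 by simp
        then show ?thesis using eQ[of l \<omega>] True by simp
      next
        case False
        then have "\<bar>est l \<omega> - \<theta> l\<bar> \<le> \<rho> * r" using that by (simp add: S_def)
        from hard_threshold_error_good[OF \<rho> r0 this] show ?thesis
          using False by (simp add: e_def G_def)
      qed
    qed (use S_int in simp)
    also have "\<dots> = G * min ((\<theta> l)\<^sup>2) (r\<^sup>2) + Q * prob S"
      using S_int by (simp add: prob_space)
    also have "prob S \<le> \<bar>K\<bar> * real n powr (- 3)"
    proof -
      have "prob S \<le> K * real n powr (- \<tau>)"
        using dev l unfolding S_def est_def \<theta>_def h_def thr by blast
      also have "\<dots> \<le> \<bar>K\<bar> * real n powr (- 3)"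
        using \<tau> n by (intro mult_mono powr_mono) auto
      finally show ?thesis .
    qed
    finally show ?thesis using Q0 by (simp add: mult_left_mono)
  qed

  obtain J where J: "1 \<le> J" "real J * x \<le> 2 * x powr \<kappa>" "real J powr (- 2 * s) \<le> x powr \<kappa>"
    using balanced_cutoff[OF x0 x1 s] unfolding \<kappa>_def by blast
  have "(\<Sum>l<n. expectation (\<lambda>\<omega>. (e l \<omega>)\<^sup>2))
      = expectation (\<lambda>\<omega>. (e 0 \<omega>)\<^sup>2) + (\<Sum>l\<in>{1..n - 1}. expectation (\<lambda>\<omega>. (e l \<omega>)\<^sup>2))"
  proof -
    have "{..<n} = insert 0 {1..n - 1}" using n by auto
    then show ?thesis by simp
  qed
  also have "(\<Sum>l\<in>{1..n - 1}. expectation (\<lambda>\<omega>. (e l \<omega>)\<^sup>2))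
      \<le> (\<Sum>l\<in>{1..n - 1}. G * min ((\<theta> l)\<^sup>2) (r\<^sup>2) + Q * (\<bar>K\<bar> * real n powr (- 3)))"
    by (rule sum_mono[OF El])
  also have "\<dots> \<le> (\<Sum>l<n. G * min ((\<theta> l)\<^sup>2) (r\<^sup>2) + Q * (\<bar>K\<bar> * real n powr (- 3)))"
    using n G0 by (intro sum_mono2) (auto simp: Q_def)
  also have "\<dots> = G * (\<Sum>l<n. min ((\<theta> l)\<^sup>2) (r\<^sup>2)) + real n * (Q * (\<bar>K\<bar> * real n powr (- 3)))"
    by (simp add: sum.distrib sum_distrib_left)
  also have "G * (\<Sum>l<n. min ((\<theta> l)\<^sup>2) (r\<^sup>2)) \<le> G * ((2 * \<gamma>\<^sup>2 + A\<^sup>2) * x powr \<kappa>)"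
  proof (rule mult_left_mono[OF _ G0])
    have "(\<Sum>l<n. min ((\<theta> l)\<^sup>2) (r\<^sup>2)) \<le> real J * r\<^sup>2 + A\<^sup>2 * real J powr (- 2 * s)"
      by (rule sobolev(3)[OF J(1)]) simp
    also have "real J * r\<^sup>2 = \<gamma>\<^sup>2 * (real J * x)" by (simp add: r2)
    also have "\<dots> \<le> \<gamma>\<^sup>2 * (2 * x powr \<kappa>)" by (rule mult_left_mono[OF J(2)]) simp
    also have "A\<^sup>2 * real J powr (- 2 * s) \<le> A\<^sup>2 * x powr \<kappa>" by (rule mult_left_mono[OF J(3)]) simp
    finally show "(\<Sum>l<n. min ((\<theta> l)\<^sup>2) (r\<^sup>2)) \<le> (2 * \<gamma>\<^sup>2 + A\<^sup>2) * x powr \<kappa>"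
      by (simp add: algebra_simps)
  qed
  \<comment> \<open>There are \<open>n\<close> exceptional terms of order \<open>n\<close> times \<open>n powr (- 3)\<close>, which fixes the exponent \<open>3\<close>.\<close>
  also have "real n * (Q * (\<bar>K\<bar> * real n powr (- 3))) \<le> 2 * (1 + A\<^sup>2) * \<bar>K\<bar> * x"
  proof -
    have "real n powr (- 3) = 1 / (real n) ^ 3"
      using n0 by (simp add: powr_minus powr_numeral inverse_eq_divide)
    then have "real n * (Q * (\<bar>K\<bar> * real n powr (- 3))) = (Q / real n) * \<bar>K\<bar> * (1 / real n)"
      using n0 by (simp add: power3_eq_cube)
    also have "\<dots> \<le> (2 * (1 + A\<^sup>2)) * \<bar>K\<bar> * x"
    proof (intro mult_mono nx)
      have "1 * (2 * A\<^sup>2) \<le> real n * (2 * A\<^sup>2)" using n by (intro mult_right_mono) auto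
      then show "Q / real n \<le> 2 * (1 + A\<^sup>2)"
        using n0 by (simp add: Q_def divide_le_eq algebra_simps)
    qed auto
    finally show ?thesis .
  qed
  finally have main: "(\<Sum>l<n. expectation (\<lambda>\<omega>. (e l \<omega>)\<^sup>2))
      \<le> expectation (\<lambda>\<omega>. (e 0 \<omega>)\<^sup>2) + (G * ((2 * \<gamma>\<^sup>2 + A\<^sup>2) * x powr \<kappa>) + 2 * (1 + A\<^sup>2) * \<bar>K\<bar> * x)"
    by simp
  have TA: "T \<le> A\<^sup>2 * x powr \<kappa>"
  proof -
    have "real n powr (- 2 * s) = (1 / real n) powr (2 * s)"
      using n0 by (simp add: powr_minus powr_divide inverse_eq_divide)
    also have "\<dots> \<le> x powr (2 * s)" using nx s by (intro powr_mono2) auto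
    also have "\<dots> \<le> x powr \<kappa>" using x0 x1 \<kappa> by (intro powr_mono') auto
    finally have "A\<^sup>2 * real n powr (- 2 * s) \<le> A\<^sup>2 * x powr \<kappa>" by (rule mult_left_mono) simp
    then show ?thesis using sobolev(2)[of n] n unfolding T_def by simp
  qed
  have "(4 * V + 4 * V\<^sup>2 + 2 * \<gamma>\<^sup>2) * x \<le> (4 * V + 4 * V\<^sup>2 + 2 * \<gamma>\<^sup>2) * x powr \<kappa>"
    using V0 by (intro mult_left_mono[OF x\<kappa>]) auto
  moreover have "2 * (1 + A\<^sup>2) * \<bar>K\<bar> * x \<le> 2 * (1 + A\<^sup>2) * \<bar>K\<bar> * x powr \<kappa>"
    by (intro mult_left_mono[OF x\<kappa>]) auto
  ultimately have "(\<Sum>l<n. expectation (\<lambda>\<omega>. (e l \<omega>)\<^sup>2)) + T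
      \<le> (4 * V + 4 * V\<^sup>2 + 2 * \<gamma>\<^sup>2) * x powr \<kappa> + G * ((2 * \<gamma>\<^sup>2 + A\<^sup>2) * x powr \<kappa>)
        + 2 * (1 + A\<^sup>2) * \<bar>K\<bar> * x powr \<kappa> + A\<^sup>2 * x powr \<kappa>"
    using main E0 TA by linarith
  also have "\<dots> = (4 * V + 4 * V\<^sup>2 + 2 * \<gamma>\<^sup>2 + G * (2 * \<gamma>\<^sup>2 + A\<^sup>2) + 2 * (1 + A\<^sup>2) * \<bar>K\<bar> + A\<^sup>2) * x powr \<kappa>"
    by (simp add: algebra_simps)
  finally show ?thesis
    unfolding risk_eq x_def[symmetric] \<kappa>_def[symmetric] by (rule ennreal_leI)
qed

theorem theorem2:
  "\<exists>\<tau>\<^sub>0>0. \<forall>(M :: 'a measure) b \<sigma> g t \<epsilon> z m\<^sub>1 m\<^sub>2 M\<^sub>2 A s \<gamma> \<tau>.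
     regression_model M b \<sigma> g t \<epsilon> z \<longrightarrow>
     0 < M\<^sub>2 \<longrightarrow>
     0 < m\<^sub>1 \<and> m\<^sub>1 \<le> m\<^sub>2 \<and> (\<forall>x\<in>{0..<b}. m\<^sub>1 \<le> g x \<and> g x \<le> m\<^sub>2) \<longrightarrow>
     0 < A \<longrightarrow> 1 / 2 \<le> s \<longrightarrow>
     0 < \<gamma> \<longrightarrow> \<tau>\<^sub>0 \<le> \<tau> \<longrightarrow>
     (\<exists>\<rho>. 0 < \<rho> \<and> \<rho> < 1 \<and>
        large_deviation_bound M b \<sigma> g t \<epsilon> z (regression_class b M\<^sub>2 s A) \<gamma> \<rho> \<tau>) \<longrightarrow>
     (\<exists>C>0. \<forall>\<^sub>F N in sequentially.
        (SUP f\<in>regression_class b M\<^sub>2 s A. risk M b \<sigma> g t \<epsilon> z N N (threshold \<gamma> N) f)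
        \<le> ennreal (C * A\<^sup>2 * (ln (real N) / (A\<^sup>2 * real N)) powr (2 * s / (2 * s + 1))))"
proof (rule exI[of _ 3], intro conjI allI impI)
  fix M :: "'a measure" and b \<sigma> g t \<epsilon> z and m\<^sub>1 m\<^sub>2 M\<^sub>2 A s \<gamma> \<tau> :: real
  assume model: "regression_model M b \<sigma> g t \<epsilon> z"
    and g: "0 < m\<^sub>1 \<and> m\<^sub>1 \<le> m\<^sub>2 \<and> (\<forall>x\<in>{0..<b}. m\<^sub>1 \<le> g x \<and> g x \<le> m\<^sub>2)"
    and A: "0 < A" and s: "1 / 2 \<le> s" and \<gamma>: "0 < \<gamma>" and \<tau>: "3 \<le> \<tau>"
    and "\<exists>\<rho>. 0 < \<rho> \<and> \<rho> < 1 \<and>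
        large_deviation_bound M b \<sigma> g t \<epsilon> z (regression_class b M\<^sub>2 s A) \<gamma> \<rho> \<tau>"
  then obtain \<rho> K where \<rho>: "0 < \<rho>" "\<rho> < 1" and
    dev: "\<forall>\<^sub>F N in sequentially. \<forall>f\<in>regression_class b M\<^sub>2 s A. \<forall>l\<in>{1..N - 1}.
        measure M {\<omega> \<in> space M.
          \<bar>coeff_estimator b \<sigma> g N (\<lambda>i. t i \<omega>) (\<lambda>i. observation f \<sigma> t \<epsilon> z i \<omega>) l
             - laguerre_coeff b (square_ext b f) l\<bar> > \<rho> * threshold \<gamma> N l}
        \<le> K * real N powr (- \<tau>)"
    unfolding large_deviation_bound_def by blast
  interpret regression_model M b \<sigma> g t \<epsilon> z by (rule model)
  define \<kappa> where "\<kappa> = 2 * s / (2 * s + 1)"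
  define V where "V = 48 * (1 / m\<^sub>1)\<^sup>2 * (M\<^sub>2 ^ 4 + \<sigma> ^ 4)
      + 2 * \<sigma> ^ 4 * (LINT u:{0..b}|lborel. laguerre_fun 0 u)\<^sup>2"
  define C\<^sub>0 where "C\<^sub>0 = 4 * V + 4 * V\<^sup>2 + 2 * \<gamma>\<^sup>2 + 4 / (1 - \<rho>)\<^sup>2 * (2 * \<gamma>\<^sup>2 + A\<^sup>2)
      + 2 * (1 + A\<^sup>2) * \<bar>K\<bar> + A\<^sup>2"
  \<comment> \<open>The power of \<open>A\<close> compensates the factors \<open>A\<^sup>2\<close> in the stated rate.\<close>
  define C where "C = C\<^sub>0 * (A\<^sup>2) powr \<kappa> / A\<^sup>2"
  have "0 \<le> V" by (simp add: V_def)
  then have "0 < C\<^sub>0" using A by (simp add: C\<^sub>0_def add_nonneg_pos)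
  then have C: "0 < C" using A by (simp add: C_def)
  have "\<forall>\<^sub>F N in sequentially.
        (SUP f\<in>regression_class b M\<^sub>2 s A. risk M b \<sigma> g t \<epsilon> z N N (threshold \<gamma> N) f)
        \<le> ennreal (C * A\<^sup>2 * (ln (real N) / (A\<^sup>2 * real N)) powr (2 * s / (2 * s + 1)))"
    using dev eventually_ge_at_top[of 3]
  proof eventually_elim
    case (elim N)
    have "C\<^sub>0 * (ln (real N) / real N) powr \<kappa> = C * A\<^sup>2 * (ln (real N) / (A\<^sup>2 * real N)) powr \<kappa>"
    proof -
      have "(ln (real N) / real N) powr \<kappa> = (A\<^sup>2 * (ln (real N) / (A\<^sup>2 * real N))) powr \<kappa>"
        using A by simp
      also have "\<dots> = (A\<^sup>2) powr \<kappa> * (ln (real N) / (A\<^sup>2 * real N)) powr \<kappa>"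
        by (rule powr_mult)
      finally show ?thesis using A by (simp add: C_def)
    qed
    moreover have "risk M b \<sigma> g t \<epsilon> z N N (threshold \<gamma> N) f \<le> ennreal (C\<^sub>0 * (ln (real N) / real N) powr \<kappa>)"
      if "f \<in> regression_class b M\<^sub>2 s A" for f
      unfolding C\<^sub>0_def V_def \<kappa>_def
      by (rule risk_le[OF that]) (use elim that g s \<rho> \<tau> \<gamma> in auto)
    ultimately show ?case
      unfolding \<kappa>_def by (intro SUP_least) simp
  qed
  with C show "\<exists>C>0. \<forall>\<^sub>F N in sequentially.
        (SUP f\<in>regression_class b M\<^sub>2 s A. risk M b \<sigma> g t \<epsilon> z N N (threshold \<gamma> N) f)
        \<le> ennreal (C * A\<^sup>2 * (ln (real N) / (A\<^sup>2 * real N)) powr (2 * s / (2 * s + 1)))"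
    by blast
qed simp

end
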